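(* Let $n\ge1$ be an integer, $0\le\alpha<1$, $L>0$, and $a(x)=\langle x\rangle^{-\alpha}$ for $x\in\mathbf{R}^n$. For any sufficiently small $\varepsilon>0$ there is some $\delta>0$ such that, with the weight $$\psi(t,x)=A\frac{\langle x\rangle^{2-\alpha}}{1+t},\qquad A=\frac{1}{(2-\alpha)^2(2+\delta)},$$ the following holds. For any integer $k\ge0$ there exists a constant $C>0$ such that for every solution $u$ of $$u_{tt}-\Delta u+a(x)u_t=0\ \text{ in }(0,\infty)\times\mathbf{R}^n,\qquad (u,u_t)(0,x)=(u_0,u_1)(x),$$ with real-valued initial data $(u_0,u_1)\in C_0^\infty(\mathbf{R}^n)$ satisfying $\mathrm{supp}\,(u_0,u_1)\subset\{|x|\le L\}$, and for all $t\ge0$, $$(1+t)^{\frac{n-\alpha}{2-\alpha}+2k-\varepsilon}\int_{\mathbf{R}^n}e^{2\psi(t,x)}a(x)|\partial_t^ku(t,x)|^2dx\le C I_k,$$ $$(1+t)^{\frac{n-\alpha}{2-\alpha}+2k+1-\varepsilon}\int_{\mathbf{R}^n}e^{2\psi(t,x)}|\nabla\partial_t^ku(t,x)|^2dx\le C I_k,$$ where $I_k$ is the weighted initial energy of $u$ defined by $$I_0=\int_{\mathbf{R}^n}e^{2\psi(0,x)}\left(u_0(x)^2+|\nabla u_0(x)|^2+|u_1(x)|^2\right)dx$$ and, inductively for $k\ge1$, $$I_k=\int_{\mathbf{R}^n}e^{2\psi(0,x)}\left(|\partial_t^{k+1}u(0,x)|^2+|\nabla\partial_t^ku(0,x)|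^2\right)dx+I_{k-1}.$$
   Context: $\langle x\rangle:=\sqrt{1+|x|^2}$; $\nabla$ and $\Delta$ act in $x$. The solution $u$ is the (smooth, real-valued) solution of the Cauchy problem, and the initial time derivatives $\partial_t^{j}u(0,x)$ are those of $u$ at $t=0$ (determined from $(u_0,u_1)$ through the equation). *)

theory Defs
  imports "HOL-Analysis.Analysis"
begin

text \<open>
  \<open>Ck_on k S f\<close>: all iterated directional derivatives of \<open>f\<close> of order at most \<open>k\<close> exist and are
  continuous on \<open>S\<close>.  Derivatives are taken within \<open>S\<close>, so that they are one-sided at boundary
  points.  The notion is meant for sets on which such derivatives are unique; below only the whole
  space and the closed half space \<open>{0..} \<times> UNIV\<close> are used.
\<close>

primrec Ck_on :: "nat \<Rightarrow> 'a::euclidean_space set \<Rightarrow> ('a \<Rightarrow> real) \<Rightarrow> bool" where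
  "Ck_on 0 S f \<longleftrightarrow> continuous_on S f"
| "Ck_on (Suc k) S f \<longleftrightarrow>
     f differentiable_on S \<and> (\<forall>v. Ck_on k S (\<lambda>x. frechet_derivative f (at x within S) v))"

definition smooth_on :: "'a::euclidean_space set \<Rightarrow> ('a \<Rightarrow> real) \<Rightarrow> bool" where
  "smooth_on S f \<longleftrightarrow> (\<forall>k. Ck_on k S f)"

definition supp :: "('a::topological_space \<Rightarrow> real) \<Rightarrow> 'a set" where
  "supp f = closure (support_on UNIV f)"

definition partial_deriv :: "'n \<Rightarrow> (real^'n \<Rightarrow> real) \<Rightarrow> real^'n \<Rightarrow> real" where
  "partial_deriv i f x = deriv (\<lambda>h. f (x + h *\<^sub>R axis i 1)) 0"

definition grad :: "(real^'n \<Rightarrow> real) \<Rightarrow> real^'n \<Rightarrow> real^'n" where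
  "grad f x = (\<chi> i. partial_deriv i f x)"

definition laplacian :: "(real^'n \<Rightarrow> real) \<Rightarrow> real^'n \<Rightarrow> real" where
  "laplacian f x = (\<Sum>i\<in>UNIV. partial_deriv i (partial_deriv i f) x)"

text \<open>
  Time derivative of a function given for \<open>t \<ge> 0\<close>: two-sided for \<open>t > 0\<close>, one-sided at \<open>t = 0\<close>.
  Its \<open>k\<close>-th iterate \<open>(time_deriv ^^ k) u\<close> is \<open>\<partial>\<^sub>t\<^sup>k u\<close>.
\<close>

definition time_deriv :: "(real \<Rightarrow> 'a \<Rightarrow> real) \<Rightarrow> real \<Rightarrow> 'a \<Rightarrow> real" where
  "time_deriv u t x = vector_derivative (\<lambda>s. u s x) (at t within {0..})"

definition bracket :: "'a::real_normed_vector \<Rightarrow> real" where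
  "bracket x = sqrt (1 + (norm x)\<^sup>2)"

definition damping :: "real \<Rightarrow> 'a::real_normed_vector \<Rightarrow> real" where
  "damping \<alpha> x = bracket x powr (-\<alpha>)"

definition weight :: "real \<Rightarrow> real \<Rightarrow> real \<Rightarrow> 'a::real_normed_vector \<Rightarrow> real" where
  "weight \<alpha> \<delta> t x = 1 / ((2 - \<alpha>)\<^sup>2 * (2 + \<delta>)) * (bracket x powr (2 - \<alpha>) / (1 + t))"

text \<open>
  Smooth solutions of the Cauchy problem, with smoothness up to \<open>t = 0\<close>.  The values of \<open>u\<close> at
  negative times are irrelevant.
\<close>

definition damped_wave_solution ::
  "real \<Rightarrow> (real^'n \<Rightarrow> real) \<Rightarrow> (real^'n \<Rightarrow> real) \<Rightarrow> (real \<Rightarrow> real^'n \<Rightarrow> real) \<Rightarrow> bool" where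
  "damped_wave_solution \<alpha> u0 u1 u \<longleftrightarrow>
     smooth_on ({0..} \<times> UNIV) (\<lambda>(t, x). u t x) \<and>
     (\<forall>t>0. \<forall>x. (time_deriv ^^ 2) u t x - laplacian (u t) x + damping \<alpha> x * time_deriv u t x = 0) \<and>
     (\<forall>x. u 0 x = u0 x \<and> time_deriv u 0 x = u1 x)"

primrec initial_energy ::
  "real \<Rightarrow> real \<Rightarrow> (real^'n \<Rightarrow> real) \<Rightarrow> (real^'n \<Rightarrow> real) \<Rightarrow> (real \<Rightarrow> real^'n \<Rightarrow> real) \<Rightarrow> nat \<Rightarrow> real"
where
  "initial_energy \<alpha> \<delta> u0 u1 u 0 =
     (LINT x|lborel. exp (2 * weight \<alpha> \<delta> 0 x) * ((u0 x)\<^sup>2 + (norm (grad u0 x))\<^sup>2 + \<bar>u1 x\<bar>\<^sup>2))"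
| "initial_energy \<alpha> \<delta> u0 u1 u (Suc k) =
     (LINT x|lborel. exp (2 * weight \<alpha> \<delta> 0 x) *
        (\<bar>(time_deriv ^^ (Suc k + 1)) u 0 x\<bar>\<^sup>2 + (norm (grad ((time_deriv ^^ Suc k) u 0) x))\<^sup>2))
     + initial_energy \<alpha> \<delta> u0 u1 u k"

end

theory Submission
  imports Defs
begin

text \<open>
  The proof is a weighted energy method. The weight \<open>\<psi>\<close> is tuned to the damping in two ways:
  \<open>a |\<psi>\<^sub>t| \<ge> (2 + \<delta>) |\<nabla>\<psi>|\<^sup>2\<close>, so that the cross terms created by the weight are absorbed by the
  damping, and \<open>\<Delta>\<psi> \<ge> B a / (1 + t)\<close> with \<open>B = (n - \<alpha>) / ((2 - \<alpha>) (2 + \<delta>))\<close>, which is where the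
  rate comes from: \<open>2 B\<close> tends to \<open>(n - \<alpha>) / (2 - \<alpha>)\<close> as \<open>\<delta>\<close> tends to \<open>0\<close>.

  For a solution \<open>v\<close> consider, with \<open>\<phi> = e\<^bsup>2\<psi>\<^esup>\<close>, the energy \<open>E = \<integral> \<phi> (v\<^sub>t\<^sup>2 + |\<nabla>v|\<^sup>2) / 2\<close> and the
  quantity \<open>H = \<integral> \<phi> (v v\<^sub>t + a v\<^sup>2 / 2)\<close>. Multiplying the equation by \<open>\<phi> v\<^sub>t\<close> and by \<open>\<phi> v\<close> gives their
  time derivatives (\<open>wave_energy_identity\<close>, \<open>wave_mass_identity\<close>). With \<open>\<tau> = t\<^sub>0 + t\<close>, a large \<open>\<mu>\<close>, a
  small \<open>\<nu>\<close> and a large \<open>t\<^sub>0\<close>, the functional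
  \<open>G = \<tau>\<^sup>M (\<mu> \<tau>\<^sup>\<alpha> E + H) + \<nu> \<tau>\<^bsup>M + 1\<^esup> E\<close> satisfies
  \<open>G' \<le> - (\<nu> / 4) \<tau>\<^bsup>M + 1\<^esup> \<integral> \<phi> a v\<^sub>t\<^sup>2 + K \<tau>\<^bsup>M - 1\<^esup> \<integral> \<phi> a v\<^sup>2\<close> whenever \<open>K + B > M / 2\<close>
  (\<open>lyapunov_functional_derivative\<close>); this is a pointwise inequality between the integrands
  (\<open>dissipation_inequality\<close>). The factor \<open>\<tau>\<^sup>\<alpha>\<close> compensates for the decay of \<open>a\<close> in space, because
  \<open>a \<tau>\<^sup>\<alpha> \<ge> 1\<close> on the support of the solution, and \<open>\<alpha> < 1\<close> makes the term \<open>\<tau>\<^bsup>\<alpha> - 1\<^esup>\<close> from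
  differentiating it negligible. In turn \<open>G\<close> dominates \<open>\<tau>\<^sup>M \<integral> \<phi> a v\<^sup>2\<close> and
  \<open>\<tau>\<^bsup>M + 1\<^esup> \<integral> \<phi> |\<nabla>v|\<^sup>2\<close>.

  For \<open>k = 0\<close> take \<open>M = (n - \<alpha>) / (2 - \<alpha>) - \<epsilon>\<close> and \<open>K = 0\<close>: then \<open>G\<close> decreases. The time derivatives
  of \<open>u\<close> solve the same equation. For \<open>\<partial>\<^sub>t\<^sup>k u\<close> the exponent \<open>M\<close> is raised by \<open>2 k\<close>, which requires
  \<open>K > 0\<close>; the resulting positive term is exactly what the functional of \<open>\<partial>\<^sub>t\<^bsup>k - 1\<^esup> u\<close> dissipates, so
  a large multiple of that functional is added (\<open>iterated_lyapunov_functional\<close>).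

  All integrals are over bounded sets because of the finite speed of propagation
  (\<open>finite_propagation_speed\<close>), which is proved with the same energy identity and another weight.
\<close>

section \<open>Smooth functions on the closed half space\<close>

definition future_smooth :: "(real \<Rightarrow> real^'n \<Rightarrow> real) \<Rightarrow> bool" where
  "future_smooth u \<longleftrightarrow> smooth_on ({0..} \<times> UNIV) (\<lambda>(t, x). u t x)"

definition future_continuous :: "(real \<Rightarrow> real^'n \<Rightarrow> 'b::topological_space) \<Rightarrow> bool" where
  "future_continuous f \<longleftrightarrow> continuous_on ({0..} \<times> UNIV) (\<lambda>z. f (fst z) (snd z))"

lemma frechet_derivative_within_cong:
  assumes "\<And>y. y \<in> S \<Longrightarrow> f y = g y" and "x \<in> S"
  shows "frechet_derivative f (at x within S) = frechet_derivative g (at x within S)"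
proof -
  have "(f has_derivative D) (at x within S) \<longleftrightarrow> (g has_derivative D) (at x within S)" for D
    using assms by (metis has_derivative_transform)
  then show ?thesis by (simp add: frechet_derivative_def)
qed

text \<open>
  Time derivatives at negative times are arbitrary, so smoothness has to be insensitive to the values
  of a function outside the set.
\<close>

lemma Ck_on_cong:
  "(\<And>x. x \<in> S \<Longrightarrow> f x = g x) \<Longrightarrow> Ck_on k S f \<Longrightarrow> Ck_on k S g"
proof (induction k arbitrary: f g)
  case 0
  then show ?case by (simp cong: continuous_on_cong)
next
  case (Suc k)
  have "g differentiable_on S"
    using Suc.prems unfolding differentiable_on_def Ck_on.simps
    by (metis differentiable_transform_within zero_less_one)
  moreover have "Ck_on k S (\<lambda>x. frechet_derivative g (at x within S) v)" for v
  proof (rule Suc.IH)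
    show "Ck_on k S (\<lambda>x. frechet_derivative f (at x within S) v)" using Suc.prems by simp
    show "frechet_derivative f (at x within S) v = frechet_derivative g (at x within S) v"
      if "x \<in> S" for x
      using frechet_derivative_within_cong[of S f g x] Suc.prems(1) that by simp
  qed
  ultimately show ?case by simp
qed

lemma smooth_on_cong: "smooth_on S f \<Longrightarrow> (\<And>x. x \<in> S \<Longrightarrow> f x = g x) \<Longrightarrow> smooth_on S g"
  unfolding smooth_on_def using Ck_on_cong by blast

lemma smooth_on_frechet_derivative:
  "smooth_on S f \<Longrightarrow> smooth_on S (\<lambda>x. frechet_derivative f (at x within S) v)"
  unfolding smooth_on_def by (metis Ck_on.simps(2))

lemma smooth_on_has_derivative:
  assumes "smooth_on S f" "x \<in> S"
  shows "(f has_derivative frechet_derivative f (at x within S)) (at x within S)"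
proof -
  have "Ck_on (Suc 0) S f" using assms(1) by (auto simp only: smooth_on_def)
  then show ?thesis
    using assms(2) by (simp add: differentiable_on_def frechet_derivative_works)
qed

lemma smooth_on_continuous: "smooth_on S f \<Longrightarrow> continuous_on S f"
  unfolding smooth_on_def by (metis Ck_on.simps(1))

lemma future_smooth_continuous: "future_smooth u \<Longrightarrow> future_continuous u"
  unfolding future_smooth_def future_continuous_def
  by (drule smooth_on_continuous) (simp add: case_prod_unfold)

lemma at_within_future_nontrivial:
  assumes "t \<ge> (0::real)"
  shows "at t within {0..} \<noteq> bot"
proof -
  have "at_right t \<le> at t within {0..}"
    using assms by (intro at_le) auto
  then show ?thesis
    using trivial_limit_at_right_real[of t] by (auto simp: bot.extremum_unique)
qed

lemma time_deriv_eqI: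
  assumes "t \<ge> 0" and "((\<lambda>s. u s x) has_real_derivative D) (at t within {0..})"
  shows "time_deriv u t x = D"
  unfolding time_deriv_def using assms
  by (intro vector_derivative_within at_within_future_nontrivial)
     (simp_all add: has_real_derivative_iff_has_vector_derivative)

lemma future_smooth_time_has_derivative:
  assumes "future_smooth u" "t \<ge> 0"
  shows "((\<lambda>s. u s x) has_real_derivative
           frechet_derivative (\<lambda>(t, x). u t x) (at (t, x) within {0..} \<times> UNIV) (1, 0))
         (at t within {0..})"
proof -
  let ?S = "{0..} \<times> (UNIV :: (real^'n) set)"
  let ?D = "frechet_derivative (\<lambda>(t, x). u t x) (at (t, x) within ?S)"
  have D: "((\<lambda>(t, x). u t x) has_derivative ?D) (at (t, x) within ?S)"
    using assms by (intro smooth_on_has_derivative) (auto simp: future_smooth_def)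
  have "((\<lambda>s. (s, x)) has_derivative (\<lambda>h. (h, 0))) (at t within {0..})"
    by (auto intro!: derivative_eq_intros)
  then have "((\<lambda>s. case (s, x) of (t, x) \<Rightarrow> u t x) has_derivative (\<lambda>h. ?D (h, 0))) (at t within {0..})"
    by (rule has_derivative_in_compose) (rule has_derivative_subset[OF D], auto)
  moreover have "(\<lambda>h. ?D (h, 0)) = (*) (?D (1, 0))"
  proof
    show "?D (h, 0) = ?D (1, 0) * h" for h
      using linear_cmul[OF has_derivative_linear[OF D], of h "(1, 0)"] by simp
  qed
  ultimately show ?thesis
    by (simp only: has_field_derivative_def prod.case)
qed

lemma future_smooth_space_has_derivative:
  assumes "future_smooth u" "t \<ge> 0"
  shows "((\<lambda>h. u t (x + h *\<^sub>R axis i 1)) has_real_derivative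
           frechet_derivative (\<lambda>(t, x). u t x)
             (at (t, x + h *\<^sub>R axis i 1) within {0..} \<times> UNIV) (0, axis i 1)) (at h)"
proof -
  let ?S = "{0..} \<times> (UNIV :: (real^'n) set)"
  let ?D = "frechet_derivative (\<lambda>(t, x). u t x) (at (t, x + h *\<^sub>R axis i 1) within ?S)"
  have D: "((\<lambda>(t, x). u t x) has_derivative ?D) (at (t, x + h *\<^sub>R axis i 1) within ?S)"
    using assms by (intro smooth_on_has_derivative) (auto simp: future_smooth_def)
  have "((\<lambda>h. (t, x + h *\<^sub>R axis i 1)) has_derivative (\<lambda>k. (0, k *\<^sub>R axis i 1))) (at h)"
    by (auto intro!: derivative_eq_intros)
  then have "((\<lambda>h. case (t, x + h *\<^sub>R axis i 1) of (t, x) \<Rightarrow> u t x) has_derivative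
      (\<lambda>k. ?D (0, k *\<^sub>R axis i 1))) (at h)"
    by (rule has_derivative_in_compose) (rule has_derivative_subset[OF D], use assms in auto)
  moreover have "(\<lambda>k. ?D (0, k *\<^sub>R axis i 1)) = (*) (?D (0, axis i 1))"
  proof
    show "?D (0, k *\<^sub>R axis i 1) = ?D (0, axis i 1) * k" for k
      using linear_cmul[OF has_derivative_linear[OF D], of k "(0, axis i 1)"] by simp
  qed
  ultimately show ?thesis
    by (simp only: has_field_derivative_def prod.case)
qed

lemma time_deriv_eq_frechet_derivative:
  assumes "future_smooth u" "t \<ge> 0"
  shows "time_deriv u t x =
    frechet_derivative (\<lambda>(t, x). u t x) (at (t, x) within {0..} \<times> UNIV) (1, 0)"
  using assms by (intro time_deriv_eqI future_smooth_time_has_derivative)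

lemma partial_deriv_eqI:
  "((\<lambda>h. f (x + h *\<^sub>R axis i 1)) has_real_derivative D) (at 0) \<Longrightarrow> partial_deriv i f x = D"
  unfolding partial_deriv_def by (rule DERIV_imp_deriv)

lemma partial_deriv_eq_frechet_derivative:
  assumes "future_smooth u" "t \<ge> 0"
  shows "partial_deriv i (u t) x =
    frechet_derivative (\<lambda>(t, x). u t x) (at (t, x) within {0..} \<times> UNIV) (0, axis i 1)"
  using future_smooth_space_has_derivative[OF assms, of x i 0]
  by (intro partial_deriv_eqI) simp

lemma has_time_deriv:
  assumes "future_smooth u" "t \<ge> 0"
  shows "((\<lambda>s. u s x) has_real_derivative time_deriv u t x) (at t within {0..})"
  using future_smooth_time_has_derivative[OF assms] time_deriv_eq_frechet_derivative[OF assms]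
  by simp

lemma has_partial_deriv:
  assumes "future_smooth u" "t \<ge> 0"
  shows "((\<lambda>h. u t (x + h *\<^sub>R axis i 1)) has_real_derivative
           partial_deriv i (u t) (x + h *\<^sub>R axis i 1)) (at h)"
  using future_smooth_space_has_derivative[OF assms] partial_deriv_eq_frechet_derivative[OF assms]
  by simp

lemma future_smooth_time_deriv:
  assumes "future_smooth u"
  shows "future_smooth (time_deriv u)"
  unfolding future_smooth_def
  by (rule smooth_on_cong[OF smooth_on_frechet_derivative[OF assms[unfolded future_smooth_def],
        of "(1, 0)"]])
     (auto simp: time_deriv_eq_frechet_derivative[OF assms])

lemma future_smooth_partial_deriv:
  assumes "future_smooth u"
  shows "future_smooth (\<lambda>t. partial_deriv i (u t))"
  unfolding future_smooth_def
  by (rule smooth_on_cong[OF smooth_on_frechet_derivative[OF assms[unfolded future_smooth_def],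
        of "(0, axis i 1)"]])
     (auto simp: partial_deriv_eq_frechet_derivative[OF assms])

lemma future_continuous_compose:
  assumes "future_continuous f" "continuous_on A g" "continuous_on A h" "\<And>z. z \<in> A \<Longrightarrow> g z \<ge> 0"
  shows "continuous_on A (\<lambda>z. f (g z) (h z))"
proof -
  have "continuous_on A (\<lambda>z. f (fst (g z, h z)) (snd (g z, h z)))"
    by (rule continuous_on_compose2[OF assms(1)[unfolded future_continuous_def]])
       (use assms in \<open>auto intro!: continuous_intros\<close>)
  then show ?thesis by simp
qed

lemma future_continuous_slice:
  "future_continuous f \<Longrightarrow> t \<ge> 0 \<Longrightarrow> continuous_on UNIV (f t)"
  by (rule future_continuous_compose) (auto intro!: continuous_intros)

lemma future_continuous_line:
  "future_continuous f \<Longrightarrow> continuous_on {0..t} (\<lambda>s. f s x)"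
  by (rule future_continuous_compose) (auto intro!: continuous_intros)

lemma time_deriv_integral:
  assumes "future_smooth u" "t \<ge> 0"
  shows "((\<lambda>s. time_deriv u s x) has_integral u t x - u 0 x) {0..t}"
proof (rule fundamental_theorem_of_calculus)
  show "((\<lambda>s. u s x) has_vector_derivative time_deriv u s x) (at s within {0..t})"
    if "s \<in> {0..t}" for s
    using has_time_deriv[OF assms(1), of s x] that
    by (auto simp: has_real_derivative_iff_has_vector_derivative
        intro: has_vector_derivative_within_subset)
qed (use assms in auto)

text \<open>
  Up to the initial time included: write \<open>u(s, y) = u(0, y) + \<integral>\<^sub>0\<^sup>s u\<^sub>t(r, y) dr\<close>, differentiate in space
  under the integral sign, and then in time by the fundamental theorem of calculus.
\<close>

lemma time_deriv_partial_deriv_commute: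
  assumes u: "future_smooth u" and t: "t \<ge> 0"
  shows "time_deriv (\<lambda>t. partial_deriv i (u t)) t = partial_deriv i (time_deriv u t)"
proof
  fix x
  let ?q = "\<lambda>s y. partial_deriv i (time_deriv u s) y"
  have q: "future_smooth ?q"
    by (intro future_smooth_partial_deriv future_smooth_time_deriv u)
  have "partial_deriv i (u s) x = partial_deriv i (u 0) x + integral {0..s} (\<lambda>r. ?q r x)"
    if s: "s \<ge> 0" for s
  proof (rule partial_deriv_eqI)
    have eq: "u s y = u 0 y + integral (cbox 0 s) (\<lambda>r. time_deriv u r y)" for y
      using time_deriv_integral[OF u s, of y] by (simp add: integral_unique)
    have "((\<lambda>h. integral (cbox 0 s) (\<lambda>r. time_deriv u r (x + h *\<^sub>R axis i 1)))
      has_real_derivative integral (cbox 0 s) (\<lambda>r. ?q r (x + 0 *\<^sub>R axis i 1))) (at 0 within UNIV)"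
    proof (rule leibniz_rule_field_derivative)
      show "((\<lambda>h. time_deriv u r (x + h *\<^sub>R axis i 1)) has_real_derivative
          ?q r (x + h *\<^sub>R axis i 1)) (at h within UNIV)" if "r \<in> cbox 0 s" for h r
        using has_partial_deriv[OF future_smooth_time_deriv[OF u]] that by simp
      show "(\<lambda>r. time_deriv u r (x + h *\<^sub>R axis i 1)) integrable_on cbox 0 s" for h
        using future_continuous_line[OF future_smooth_continuous[OF future_smooth_time_deriv[OF u]]]
        by (intro integrable_continuous) simp
      show "continuous_on (UNIV \<times> cbox 0 s) (\<lambda>(h, r). ?q r (x + h *\<^sub>R axis i 1))"
        unfolding case_prod_unfold
        by (rule future_continuous_compose[OF future_smooth_continuous[OF q]])
           (auto intro!: continuous_intros)
    qed auto
    moreover have "((\<lambda>h. u 0 (x + h *\<^sub>R axis i 1)) has_real_derivative partial_deriv i (u 0) x) (at 0)"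
      using has_partial_deriv[OF u, of 0 x i 0] by simp
    ultimately show "((\<lambda>h. u s (x + h *\<^sub>R axis i 1)) has_real_derivative
        partial_deriv i (u 0) x + integral {0..s} (\<lambda>r. ?q r x)) (at 0)"
      by (subst eq) (auto intro!: derivative_eq_intros)
  qed
  note eq = this
  show "time_deriv (\<lambda>t. partial_deriv i (u t)) t x = ?q t x"
  proof (rule time_deriv_eqI[OF t])
    have "((\<lambda>s. integral {0..s} (\<lambda>r. ?q r x)) has_real_derivative ?q t x) (at t within {0..t + 1})"
      using t by (intro integral_has_real_derivative future_continuous_line future_smooth_continuous q) auto
    then have "((\<lambda>s. partial_deriv i (u 0) x + integral {0..s} (\<lambda>r. ?q r x)) has_real_derivative ?q t x)
        (at t within {0..t + 1})"
      by (auto intro!: derivative_eq_intros)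
    then have "((\<lambda>s. partial_deriv i (u s) x) has_real_derivative ?q t x) (at t within {0..t + 1})"
      by (rule has_field_derivative_transform_within[where d = 1]) (use t in \<open>auto intro: eq[symmetric]\<close>)
    moreover have "at t within {0..t + 1} = at t within {0..}"
      by (rule at_within_nhd[of t "{..<t + 1}"]) auto
    ultimately show "((\<lambda>s. partial_deriv i (u s) x) has_real_derivative ?q t x) (at t within {0..})"
      by simp
  qed
qed

section \<open>Integrals of compactly supported functions\<close>

lemma cbox_containing_cball:
  obtains a b :: "real^'n" where "cball 0 R \<subseteq> cbox a b"
  using bounded_subset_cbox_symmetric[OF bounded_cball] by blast

lemma
  fixes f :: "real^'n \<Rightarrow> real"
  assumes "continuous_on UNIV f" and zero: "\<And>x. norm x > R \<Longrightarrow> f x = 0"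
  shows integrable_compact_support: "integrable lborel f"
    and space_integral_eq_integral_cbox:
      "cball 0 R \<subseteq> cbox a b \<Longrightarrow> (LINT x|lborel. f x) = integral (cbox a b) f"
proof -
  have *: "integrable lborel f \<and> (LINT x|lborel. f x) = integral (cbox a b) f"
    if sub: "cball 0 R \<subseteq> cbox a b" for a b
  proof -
    have eq: "(\<lambda>x. indicator (cbox a b) x *\<^sub>R f x) = f"
    proof
      show "indicator (cbox a b) x *\<^sub>R f x = f x" for x
        using sub zero[of x] by (cases "norm x > R") (auto simp: indicator_def subset_iff)
    qed
    have "set_integrable lborel (cbox a b) f"
      unfolding set_integrable_def
      by (intro borel_integrable_compact continuous_on_subset[OF assms(1)]) auto
    from this set_borel_integral_eq_integral(2)[OF this] show ?thesis
      unfolding set_integrable_def set_lebesgue_integral_def eq by simp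
  qed
  show "integrable lborel f"
    using * cbox_containing_cball by metis
  show "cball 0 R \<subseteq> cbox a b \<Longrightarrow> (LINT x|lborel. f x) = integral (cbox a b) f"
    using * by blast
qed

lemma nonneg_continuous_space_integral_zero:
  fixes f :: "real^'n \<Rightarrow> real"
  assumes "continuous_on UNIV f" "\<And>x. norm x > R \<Longrightarrow> f x = 0" "\<And>x. f x \<ge> 0"
    and "(LINT x|lborel. f x) \<le> 0"
  shows "f x = 0"
proof -
  obtain a b :: "real^'n" where ab: "cball 0 (max (R + 1) (norm x)) \<subseteq> cbox a b"
    using cbox_containing_cball .
  have cont: "continuous_on (cbox a b) f"
    using assms(1) continuous_on_subset by blast
  have "(LINT x|lborel. f x) = integral (cbox a b) f"
    using ab by (intro space_integral_eq_integral_cbox[where R = R] assms) auto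
  moreover have "integral (cbox a b) f \<ge> 0"
    using assms(3) by (intro integral_nonneg integrable_continuous cont)
  ultimately have "integral (cbox a b) f = 0"
    using assms(4) by simp
  then have int: "(f has_integral 0) (cbox a b)"
    using integrable_integral[OF integrable_continuous[OF cont]] by simp
  show ?thesis
  proof (cases "box a b = {}")
    case True
    \<comment> \<open>The box contains a ball of radius at least \<open>R + 1\<close>, so it is degenerate only if
      \<open>R \<le> -1\<close>, and then \<open>f\<close> vanishes everywhere by assumption.\<close>
    have "ball 0 (max (R + 1) (norm x)) \<subseteq> interior (cbox a b)"
      using ab ball_subset_cball by (intro interior_maximal) (auto simp: subset_iff)
    with True have "ball (0::real^'n) (max (R + 1) (norm x)) = {}"
      by (simp add: interior_cbox)
    then have "R + 1 \<le> 0" by (simp add: ball_eq_empty)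
    then show ?thesis using assms(2)[of x] norm_ge_zero[of x] by simp
  next
    case False
    have "x \<in> cbox a b"
      using ab by auto
    with False show ?thesis
      using has_integral_0_cbox_imp_0[OF cont _ int] assms(3) by blast
  qed
qed

text \<open>
  The support is contained in a fixed box while \<open>t \<le> T\<close>, and Leibniz's rule applies there.
\<close>

lemma has_derivative_space_integral:
  fixes F F' :: "real \<Rightarrow> real^'n \<Rightarrow> real"
  assumes F: "future_continuous F" and F': "future_continuous F'"
    and deriv: "\<And>t x. t \<ge> 0 \<Longrightarrow> ((\<lambda>s. F s x) has_real_derivative F' t x) (at t within {0..})"
    and zero: "\<And>t x. 0 \<le> t \<Longrightarrow> t \<le> T \<Longrightarrow> norm x > R \<Longrightarrow> F t x = 0"
    and t: "0 \<le> t" "t \<le> T" "0 < T"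
  shows "((\<lambda>t. LINT x|lborel. F t x) has_real_derivative (LINT x|lborel. F' t x)) (at t within {0..T})"
    and "norm x > R \<Longrightarrow> F' t x = 0"
proof -
  have derivT: "((\<lambda>s. F s x) has_real_derivative F' s x) (at s within {0..T})" if "s \<in> {0..T}" for s x
    using deriv[of s x] that by (auto intro: DERIV_subset)
  have F'0: "F' t x = 0" if "norm x > R" for x
  proof -
    have "((\<lambda>s. F s x) has_real_derivative 0) (at t within {0..T})"
      by (rule has_field_derivative_transform_within[where d = 1 and f = "\<lambda>_. 0"])
         (use zero[of _ x] that t in auto)
    with derivT[of t x] show ?thesis
      using t vector_derivative_unique_within_closed_interval[of 0 T t "\<lambda>s. F s x" "F' t x" 0]
      by (auto simp: has_real_derivative_iff_has_vector_derivative)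
  qed
  then show "norm x > R \<Longrightarrow> F' t x = 0" by blast
  obtain a b :: "real^'n" where ab: "cball 0 R \<subseteq> cbox a b"
    using cbox_containing_cball .
  have "((\<lambda>s. integral (cbox a b) (F s)) has_real_derivative integral (cbox a b) (F' t))
      (at t within {0..T})"
  proof (rule leibniz_rule_field_derivative)
    show "F s integrable_on cbox a b" if "s \<in> {0..T}" for s
      using that future_continuous_slice[OF F, of s]
      by (intro integrable_continuous) (auto intro: continuous_on_subset)
    show "continuous_on ({0..T} \<times> cbox a b) (\<lambda>(t, x). F' t x)"
      unfolding case_prod_unfold
      by (rule future_continuous_compose[OF F']) (auto intro!: continuous_intros)
  qed (use derivT t in auto)
  moreover have "(LINT x|lborel. F' t x) = integral (cbox a b) (F' t)"
    using future_continuous_slice[OF F' t(1)] F'0 ab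
    by (intro space_integral_eq_integral_cbox[where R = R])
  moreover have "(LINT x|lborel. F s x) = integral (cbox a b) (F s)" if "s \<in> {0..T}" for s
    using that future_continuous_slice[OF F, of s] zero[of s] ab
    by (intro space_integral_eq_integral_cbox[where R = R]) auto
  ultimately have "((\<lambda>s. integral (cbox a b) (F s)) has_real_derivative (LINT x|lborel. F' t x))
      (at t within {0..T})" and eq: "\<And>s. s \<in> {0..T} \<Longrightarrow> (LINT x|lborel. F s x) = integral (cbox a b) (F s)"
    by simp_all
  then show "((\<lambda>t. LINT x|lborel. F t x) has_real_derivative (LINT x|lborel. F' t x))
      (at t within {0..T})"
    by (rule_tac has_field_derivative_transform_within[where d = 1]) (use t in simp_all)
qed

text \<open>
  The divergence theorem on the whole space follows from translation invariance: the integral of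
  \<open>g (x + h e)\<close> does not depend on \<open>h\<close>, and its derivative in \<open>h\<close> at \<open>0\<close> is the integral of the
  derivative of \<open>g\<close> along \<open>e\<close>.
\<close>

lemma space_integral_partial_derivative_zero:
  fixes g g' :: "real^'n \<Rightarrow> real"
  assumes g: "continuous_on UNIV g" and g': "continuous_on UNIV g'"
    and deriv: "\<And>x. ((\<lambda>h. g (x + h *\<^sub>R axis i 1)) has_real_derivative g' x) (at 0)"
    and zero: "\<And>x. norm x > R \<Longrightarrow> g x = 0"
  shows "(LINT x|lborel. g' x) = 0" and "norm x > R \<Longrightarrow> g' x = 0"
proof -
  let ?e = "axis i 1 :: real^'n"
  have g'0: "g' x = 0" if "norm x > R" for x
  proof -
    have "((\<lambda>h. g (x + h *\<^sub>R ?e)) has_real_derivative 0) (at 0)"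
    proof (rule has_field_derivative_transform_within[where d = "norm x - R" and f = "\<lambda>_. 0"])
      show "0 = g (x + h *\<^sub>R ?e)" if "dist h 0 < norm x - R" for h
        using that norm_triangle_ineq2[of x "- h *\<^sub>R ?e"] zero[of "x + h *\<^sub>R ?e"] by simp
    qed (use that in auto)
    with deriv[of x] show ?thesis by (rule DERIV_unique)
  qed
  then show "norm x > R \<Longrightarrow> g' x = 0" by blast
  obtain a b :: "real^'n" where ab: "cball 0 (R + 1) \<subseteq> cbox a b"
    using cbox_containing_cball .
  have deriv_h: "((\<lambda>h. g (x + h *\<^sub>R ?e)) has_real_derivative g' (x + h *\<^sub>R ?e)) (at h)" for x h
    using deriv[of "x + h *\<^sub>R ?e"] DERIV_shift[of "\<lambda>h. g (x + h *\<^sub>R ?e)" "g' (x + h *\<^sub>R ?e)" 0 h]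
    by (simp add: algebra_simps)
  have leibniz: "((\<lambda>h. integral (cbox a b) (\<lambda>x. g (x + h *\<^sub>R ?e))) has_real_derivative
      integral (cbox a b) (\<lambda>x. g' (x + 0 *\<^sub>R ?e))) (at 0 within {-1<..<1})"
  proof (rule leibniz_rule_field_derivative)
    show "(\<lambda>x. g (x + h *\<^sub>R ?e)) integrable_on cbox a b" for h
      by (intro integrable_continuous continuous_on_compose2[OF g]) (auto intro!: continuous_intros)
    show "continuous_on ({-1<..<1} \<times> cbox a b) (\<lambda>(h, x). g' (x + h *\<^sub>R ?e))"
      unfolding case_prod_unfold
      by (intro continuous_on_compose2[OF g']) (auto intro!: continuous_intros)
  qed (auto intro: DERIV_subset[OF deriv_h])
  have "integral (cbox a b) (\<lambda>x. g (x + h *\<^sub>R ?e)) = (LINT x|lborel. g x)"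
    if h: "h \<in> {-1<..<1}" for h
  proof -
    have "norm x - 1 < norm (x + h *\<^sub>R ?e)" for x
      using norm_triangle_ineq2[of x "- h *\<^sub>R ?e"] h abs_less_iff[of h 1] by simp
    then have "g (x + h *\<^sub>R ?e) = 0" if "norm x > R + 1" for x
      using zero[of "x + h *\<^sub>R ?e"] that by (smt (verit))
    then have "integral (cbox a b) (\<lambda>x. g (x + h *\<^sub>R ?e)) = (LINT x|lborel. g (x + h *\<^sub>R ?e))"
      using ab
      by (intro space_integral_eq_integral_cbox[where R = "R + 1", symmetric]
            continuous_on_compose2[OF g]) (auto intro!: continuous_intros)
    also have "\<dots> = (LINT x|distr lborel borel ((+) (h *\<^sub>R ?e)). g x)"
      using borel_measurable_continuous_onI[OF g]
      by (subst integral_distr) (auto simp: add.commute)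
    also have "\<dots> = (LINT x|lborel. g x)"
      by (simp add: lborel_distr_plus)
    finally show ?thesis .
  qed
  note eq = this
  have "((\<lambda>h. LINT x|lborel. g x) has_real_derivative integral (cbox a b) g') (at 0 within {-1<..<1})"
  proof (rule has_field_derivative_transform_within[where d = 1])
    show "((\<lambda>h. integral (cbox a b) (\<lambda>x. g (x + h *\<^sub>R ?e))) has_real_derivative
        integral (cbox a b) g') (at 0 within {-1<..<1})"
      using leibniz by (simp only: scaleR_zero_left add_0_right)
    show "integral (cbox a b) (\<lambda>x. g (x + h *\<^sub>R ?e)) = (LINT x|lborel. g x)"
      if "h \<in> {-1<..<1}" for h
      by (rule eq[OF that])
  qed simp_all
  then have "((\<lambda>h. LINT x|lborel. g x) has_real_derivative integral (cbox a b) g') (at 0)"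
    using at_within_open[of 0 "{-1<..<1::real}"] by simp
  then have "integral (cbox a b) g' = 0"
    by (rule DERIV_unique) simp
  moreover have "(LINT x|lborel. g' x) = integral (cbox a b) g'"
    using ab g'0 g' by (intro space_integral_eq_integral_cbox[where R = R]) auto
  ultimately show "(LINT x|lborel. g' x) = 0" by simp
qed

section \<open>Weighted energy identities for damped waves\<close>

definition damped_wave :: "(real^'n \<Rightarrow> real) \<Rightarrow> (real \<Rightarrow> real^'n \<Rightarrow> real) \<Rightarrow> bool" where
  "damped_wave a v \<longleftrightarrow> future_smooth v \<and>
     (\<forall>t>0. \<forall>x. time_deriv (time_deriv v) t x - laplacian (v t) x + a x * time_deriv v t x = 0)"

lemma laplacian_time_deriv_commute:
  assumes v: "future_smooth v" and t: "t \<ge> 0"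
  shows "((\<lambda>s. laplacian (v s) x) has_real_derivative laplacian (time_deriv v t) x) (at t within {0..})"
proof -
  have "((\<lambda>s. partial_deriv i (partial_deriv i (v s)) x) has_real_derivative
      partial_deriv i (partial_deriv i (time_deriv v t)) x) (at t within {0..})" for i
    using has_time_deriv[OF future_smooth_partial_deriv[OF future_smooth_partial_deriv[OF v]] t]
      time_deriv_partial_deriv_commute[OF future_smooth_partial_deriv[OF v] t]
      time_deriv_partial_deriv_commute[OF v t]
    by simp
  then show ?thesis
    unfolding laplacian_def by (intro DERIV_sum)
qed

text \<open>The coefficients do not depend on time, so time derivatives of solutions are solutions.\<close>

lemma damped_wave_time_deriv:
  fixes v :: "real \<Rightarrow> real^'n \<Rightarrow> real"
  assumes "damped_wave a v"
  shows "damped_wave a (time_deriv v)"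
  unfolding damped_wave_def
proof (intro conjI allI impI)
  have v: "future_smooth v" and
    eq: "\<And>t x. t > 0 \<Longrightarrow> time_deriv (time_deriv v) t x - laplacian (v t) x + a x * time_deriv v t x = 0"
    using assms by (auto simp: damped_wave_def)
  show "future_smooth (time_deriv v)" by (intro future_smooth_time_deriv v)
  fix t :: real and x :: "real^'n"
  assume t: "t > 0"
  let ?L = "\<lambda>t. time_deriv (time_deriv v) t x - laplacian (v t) x + a x * time_deriv v t x"
  have "(?L has_real_derivative time_deriv (time_deriv (time_deriv v)) t x
      - laplacian (time_deriv v t) x + a x * time_deriv (time_deriv v) t x) (at t within {0..})"
    using t v by (intro DERIV_add DERIV_diff DERIV_cmult has_time_deriv laplacian_time_deriv_commute
        future_smooth_time_deriv) auto
  moreover have "at t within {0..} = at t"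
    using t by (intro at_within_interior) auto
  moreover have "(?L has_real_derivative 0) (at t)"
  proof (rule has_field_derivative_transform_within[where d = t and f = "\<lambda>_. 0"])
    show "0 = ?L s" if "dist s t < t" for s
      using that by (intro eq[symmetric]) (auto simp: dist_real_def)
  qed (use t in simp_all)
  ultimately show "time_deriv (time_deriv (time_deriv v)) t x
      - laplacian (time_deriv v t) x + a x * time_deriv (time_deriv v) t x = 0"
    using DERIV_unique[of ?L _ t 0] by simp
qed

lemma norm_grad_square: "(norm (grad f x))\<^sup>2 = (\<Sum>i\<in>UNIV. (partial_deriv i f x)\<^sup>2)"
  unfolding power2_norm_eq_inner by (simp add: inner_vec_def grad_def power2_eq_square)

lemma inner_grad: "y \<bullet> grad f x = (\<Sum>i\<in>UNIV. y $ i * partial_deriv i f x)"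
  by (simp add: inner_vec_def grad_def)

lemma future_continuous_grad:
  assumes "future_smooth v"
  shows "future_continuous (\<lambda>t. grad (v t))"
  unfolding future_continuous_def grad_def
  using future_smooth_continuous[OF future_smooth_partial_deriv[OF assms]]
  by (auto intro!: continuous_on_vec_lambda simp: future_continuous_def)

text \<open>
  The derivatives are explicit parameters because the weights used below are given by formulas, and
  one of them is only once continuously differentiable.
\<close>

definition C1_weight ::
  "(real \<Rightarrow> real^'n \<Rightarrow> real) \<Rightarrow> (real \<Rightarrow> real^'n \<Rightarrow> real) \<Rightarrow> (real \<Rightarrow> real^'n \<Rightarrow> real^'n) \<Rightarrow> bool" where
  "C1_weight \<phi> \<phi>t \<phi>x \<longleftrightarrow>
     future_continuous \<phi> \<and> future_continuous \<phi>t \<and> future_continuous \<phi>x \<and>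
     (\<forall>t\<ge>0. \<forall>x. ((\<lambda>s. \<phi> s x) has_real_derivative \<phi>t t x) (at t within {0..})) \<and>
     (\<forall>t\<ge>0. \<forall>x i. ((\<lambda>h. \<phi> t (x + h *\<^sub>R axis i 1)) has_real_derivative \<phi>x t x $ i) (at 0))"

definition wave_energy :: "(real \<Rightarrow> real^'n \<Rightarrow> real) \<Rightarrow> (real \<Rightarrow> real^'n \<Rightarrow> real) \<Rightarrow> real \<Rightarrow> real" where
  "wave_energy \<phi> v t =
     (LINT x|lborel. \<phi> t x * ((time_deriv v t x)\<^sup>2 + (norm (grad (v t) x))\<^sup>2) / 2)"

definition wave_mass ::
  "(real^'n \<Rightarrow> real) \<Rightarrow> (real \<Rightarrow> real^'n \<Rightarrow> real) \<Rightarrow> (real \<Rightarrow> real^'n \<Rightarrow> real) \<Rightarrow> real \<Rightarrow> real" where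
  "wave_mass a \<phi> v t =
     (LINT x|lborel. \<phi> t x * (v t x * time_deriv v t x + a x * (v t x)\<^sup>2 / 2))"

locale weighted_damped_wave =
  fixes a :: "real^'n \<Rightarrow> real" and v \<phi> \<phi>t :: "real \<Rightarrow> real^'n \<Rightarrow> real"
    and \<phi>x :: "real \<Rightarrow> real^'n \<Rightarrow> real^'n"
  assumes wave: "damped_wave a v" and damping_continuous: "continuous_on UNIV a"
    and weight: "C1_weight \<phi> \<phi>t \<phi>x"
begin

abbreviation (input) "p \<equiv> time_deriv v"
abbreviation (input) "q \<equiv> time_deriv (time_deriv v)"
abbreviation (input) "w i \<equiv> (\<lambda>t. partial_deriv i (v t))"
abbreviation (input) "z i \<equiv> (\<lambda>t. partial_deriv i (time_deriv v t))"
abbreviation (input) "r i \<equiv> (\<lambda>t. partial_deriv i (partial_deriv i (v t)))"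

lemma smooth: "future_smooth v" "future_smooth p" "future_smooth (w i)"
proof -
  show v: "future_smooth v" using wave by (simp add: damped_wave_def)
  show "future_smooth p" "future_smooth (w i)"
    by (intro future_smooth_time_deriv future_smooth_partial_deriv v)+
qed

lemma equation:
  assumes "t > 0"
  shows "q t x + a x * p t x = (\<Sum>i\<in>UNIV. r i t x)"
proof -
  have "q t x - laplacian (v t) x + a x * p t x = 0"
    using wave assms by (simp add: damped_wave_def)
  then show ?thesis
    unfolding laplacian_def by linarith
qed

lemma deriv_time:
  assumes "t \<ge> 0"
  shows "((\<lambda>s. v s x) has_real_derivative p t x) (at t within {0..})"
    and "((\<lambda>s. p s x) has_real_derivative q t x) (at t within {0..})"
    and "((\<lambda>s. w i s x) has_real_derivative z i t x) (at t within {0..})"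
    and "((\<lambda>s. \<phi> s x) has_real_derivative \<phi>t t x) (at t within {0..})"
  using has_time_deriv[OF smooth(1) assms] has_time_deriv[OF smooth(2) assms]
    has_time_deriv[OF smooth(3) assms, of i x]
    time_deriv_partial_deriv_commute[OF smooth(1) assms, of i] weight assms
  by (simp_all add: C1_weight_def)

lemma deriv_space:
  assumes "t \<ge> 0"
  shows "((\<lambda>h. v t (x + h *\<^sub>R axis i 1)) has_real_derivative w i t x) (at 0)"
    and "((\<lambda>h. p t (x + h *\<^sub>R axis i 1)) has_real_derivative z i t x) (at 0)"
    and "((\<lambda>h. w i t (x + h *\<^sub>R axis i 1)) has_real_derivative r i t x) (at 0)"
    and "((\<lambda>h. \<phi> t (x + h *\<^sub>R axis i 1)) has_real_derivative \<phi>x t x $ i) (at 0)"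
  using has_partial_deriv[OF smooth(1) assms, of x i 0] has_partial_deriv[OF smooth(2) assms, of x i 0]
    has_partial_deriv[OF smooth(3) assms, of i x i 0] weight assms
  by (simp_all add: C1_weight_def)

lemma continuous:
  "future_continuous v" "future_continuous p" "future_continuous q" "future_continuous (w i)"
  "future_continuous (z i)" "future_continuous (r i)"
  "future_continuous \<phi>" "future_continuous \<phi>t" "future_continuous \<phi>x"
  "future_continuous (\<lambda>t. a)"
proof -
  show "future_continuous \<phi>" "future_continuous \<phi>t" "future_continuous \<phi>x"
    using weight by (auto simp: C1_weight_def)
  show "future_continuous (\<lambda>t. a)"
    unfolding future_continuous_def
    by (rule continuous_on_compose2[OF damping_continuous]) (auto intro!: continuous_intros)
qed (intro future_smooth_continuous smooth future_smooth_time_deriv future_smooth_partial_deriv)+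

lemmas continuous_slice = continuous[THEN future_continuous_slice]
lemmas continuous_joint = continuous[unfolded future_continuous_def]

lemma continuous_on_of_derivative_within:
  assumes "\<And>t. 0 \<le> t \<Longrightarrow> t \<le> T \<Longrightarrow> 0 < T \<Longrightarrow> (E has_real_derivative E' t) (at t within {0..T})"
  shows "continuous_on {0..T} E"
proof (cases "T > 0")
  case True
  then show ?thesis
    unfolding continuous_on_eq_continuous_within using assms by (auto intro!: DERIV_continuous)
next
  case False
  then have "{0..T} \<subseteq> {0}" by auto
  then show ?thesis by (meson continuous_on_sing continuous_on_subset)
qed

text \<open>
  Multiplication of the equation by \<open>\<phi> v\<^sub>t\<close>: the time derivative of the energy density and the
  integrand \<open>Q\<close> differ by the divergence of \<open>\<phi> v\<^sub>t \<nabla>v\<close>, which integrates to zero. For compact support it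
  is enough that at each far away point either the weight or the derivatives of \<open>v\<close> vanish: the light
  cone weight has the first property, the exponential weight relies on the second.
\<close>

lemma wave_energy_identity:
  assumes zero: "\<And>t x. 0 \<le> t \<Longrightarrow> t \<le> T \<Longrightarrow> norm x > R \<Longrightarrow>
      \<phi> t x = 0 \<or> (p t x = 0 \<and> grad (v t) x = 0)"
  defines "Q \<equiv> \<lambda>t x. \<phi>t t x * ((p t x)\<^sup>2 + (norm (grad (v t) x))\<^sup>2) / 2
      - a x * \<phi> t x * (p t x)\<^sup>2 - p t x * (\<phi>x t x \<bullet> grad (v t) x)"
  shows "continuous_on {0..T} (wave_energy \<phi> v)"
    and "0 < t \<Longrightarrow> t < T \<Longrightarrow> integrable lborel (Q t)"
    and "0 < t \<Longrightarrow> t < T \<Longrightarrow> (wave_energy \<phi> v has_real_derivative (LINT x|lborel. Q t x)) (at t)"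
proof -
  define F where "F = (\<lambda>t x. \<phi> t x * ((p t x)\<^sup>2 + (\<Sum>i\<in>UNIV. (w i t x)\<^sup>2)) / 2)"
  define F' where "F' = (\<lambda>t x. \<phi>t t x * ((p t x)\<^sup>2 + (\<Sum>i\<in>UNIV. (w i t x)\<^sup>2)) / 2
    + \<phi> t x * (p t x * q t x + (\<Sum>i\<in>UNIV. w i t x * z i t x)))"
  define g where "g = (\<lambda>i t x. \<phi> t x * p t x * w i t x)"
  define g' where "g' = (\<lambda>i t x. \<phi>x t x $ i * p t x * w i t x + \<phi> t x * z i t x * w i t x
    + \<phi> t x * p t x * r i t x)"
  have energy: "wave_energy \<phi> v t = (LINT x|lborel. F t x)" for t
    unfolding wave_energy_def F_def norm_grad_square ..
  have zero': "\<phi> t x = 0 \<or> (p t x = 0 \<and> (\<forall>i. w i t x = 0))"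
    if "0 \<le> t" "t \<le> T" "norm x > R" for t x
    using zero[OF that] by (auto simp: grad_def vec_eq_iff)
  have F0: "F t x = 0" if "0 \<le> t" "t \<le> T" "norm x > R" for t x
    using zero'[OF that] by (auto simp: F_def)
  have F: "future_continuous F" "future_continuous F'"
    unfolding F_def F'_def future_continuous_def by (intro continuous_intros continuous_joint; simp)+
  have F_deriv: "((\<lambda>s. F s x) has_real_derivative F' t x) (at t within {0..})" if "t \<ge> 0" for t x
    unfolding F_def F'_def
    by (rule derivative_eq_intros deriv_time that refl | simp)+
       (simp add: sum_distrib_left sum_distrib_right field_simps)
  have E: "((\<lambda>t. LINT x|lborel. F t x) has_real_derivative (LINT x|lborel. F' t x)) (at t within {0..T})"
    if "0 \<le> t" "t \<le> T" "0 < T" for t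
    by (rule has_derivative_space_integral(1)[OF F F_deriv F0 that])
  show "continuous_on {0..T} (wave_energy \<phi> v)"
    unfolding energy by (rule continuous_on_of_derivative_within[OF E])
  assume t: "0 < t" "t < T"
  have F'0: "F' t x = 0" if "norm x > R" for x
    by (rule has_derivative_space_integral(2)[OF F F_deriv F0 _ _ _ that]) (use t in auto)
  have g0: "g i t x = 0" if "norm x > R" for i x
    using zero'[of t x] that t by (auto simp: g_def)
  have g: "continuous_on UNIV (g i t)" "continuous_on UNIV (g' i t)" for i
    unfolding g_def g'_def using t by (intro continuous_intros continuous_slice; simp)+
  have g_deriv: "((\<lambda>h. g i t (x + h *\<^sub>R axis i 1)) has_real_derivative g' i t x) (at 0)" for i x
    unfolding g_def g'_def using t
    by (auto intro!: derivative_eq_intros deriv_space simp: algebra_simps)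
  note D = space_integral_partial_derivative_zero[OF g g_deriv g0]
  have Q: "Q t x = F' t x - (\<Sum>i\<in>UNIV. g' i t x)" for x
  proof -
    have "(\<Sum>i\<in>UNIV. g' i t x) = p t x * (\<phi>x t x \<bullet> grad (v t) x)
        + \<phi> t x * (\<Sum>i\<in>UNIV. w i t x * z i t x) + \<phi> t x * p t x * (q t x + a x * p t x)"
      unfolding equation[OF t(1)] inner_grad g'_def
      by (simp add: sum.distrib sum_distrib_left algebra_simps)
    then show ?thesis
      unfolding Q_def F'_def norm_grad_square by (simp add: algebra_simps power2_eq_square)
  qed
  have int_F': "integrable lborel (F' t)"
    using t F(2) F'0
    by (intro integrable_compact_support[where R = R] future_continuous_slice) auto
  have int_g': "integrable lborel (g' i t)" for i
    using D(2) g(2) by (intro integrable_compact_support[where R = R]) auto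
  show "integrable lborel (Q t)"
    unfolding Q using int_F' int_g' by auto
  have "(LINT x|lborel. Q t x) = (LINT x|lborel. F' t x)"
    unfolding Q using int_F' int_g' D(1) by simp
  moreover have "at t within {0..T} = at t"
    using t by (intro at_within_interior) auto
  ultimately show "(wave_energy \<phi> v has_real_derivative (LINT x|lborel. Q t x)) (at t)"
    using E[of t] t unfolding energy[abs_def] by simp
qed

text \<open>
  Multiplication of the equation by \<open>\<phi> v\<close>. The divergence that integrates to zero is that of
  \<open>\<phi> v \<nabla>v + v\<^sup>2 \<nabla>\<phi> / 2\<close>. Its second summand doubles the cross term \<open>v \<nabla>\<phi> \<cdot> \<nabla>v\<close>, in exchange for the
  term with the Laplacian of the weight, which later yields the decay rate.
\<close>

lemma wave_mass_identity:
  assumes zero: "\<And>t x. 0 \<le> t \<Longrightarrow> t \<le> T \<Longrightarrow> norm x > R \<Longrightarrow> v t x = 0"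
    and hess: "\<And>t x i. t \<ge> 0 \<Longrightarrow>
      ((\<lambda>h. \<phi>x t (x + h *\<^sub>R axis i 1) $ i) has_real_derivative \<phi>xx i t x) (at 0)"
    and hess_continuous: "\<And>i. future_continuous (\<phi>xx i)"
  defines "Q \<equiv> \<lambda>t x. \<phi>t t x * (v t x * p t x + a x * (v t x)\<^sup>2 / 2)
      + \<phi> t x * ((p t x)\<^sup>2 - (norm (grad (v t) x))\<^sup>2)
      - 2 * v t x * (\<phi>x t x \<bullet> grad (v t) x) - (v t x)\<^sup>2 * (\<Sum>i\<in>UNIV. \<phi>xx i t x) / 2"
  shows "continuous_on {0..T} (wave_mass a \<phi> v)"
    and "0 < t \<Longrightarrow> t < T \<Longrightarrow> integrable lborel (Q t)"
    and "0 < t \<Longrightarrow> t < T \<Longrightarrow> (wave_mass a \<phi> v has_real_derivative (LINT x|lborel. Q t x)) (at t)"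
proof -
  define F where "F = (\<lambda>t x. \<phi> t x * (v t x * p t x + a x * (v t x)\<^sup>2 / 2))"
  define F' where "F' = (\<lambda>t x. \<phi>t t x * (v t x * p t x + a x * (v t x)\<^sup>2 / 2)
    + \<phi> t x * ((p t x)\<^sup>2 + v t x * q t x + a x * v t x * p t x))"
  define g where "g = (\<lambda>i t x. \<phi> t x * v t x * w i t x + (v t x)\<^sup>2 * \<phi>x t x $ i / 2)"
  define g' where "g' = (\<lambda>i t x. 2 * v t x * (\<phi>x t x $ i * w i t x) + \<phi> t x * (w i t x)\<^sup>2
    + \<phi> t x * v t x * r i t x + (v t x)\<^sup>2 * \<phi>xx i t x / 2)"
  have mass: "wave_mass a \<phi> v t = (LINT x|lborel. F t x)" for t
    unfolding wave_mass_def F_def ..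
  have F0: "F t x = 0" if "0 \<le> t" "t \<le> T" "norm x > R" for t x
    using zero[OF that] by (auto simp: F_def)
  have F: "future_continuous F" "future_continuous F'"
    unfolding F_def F'_def future_continuous_def by (intro continuous_intros continuous_joint; simp)+
  have F_deriv: "((\<lambda>s. F s x) has_real_derivative F' t x) (at t within {0..})" if "t \<ge> 0" for t x
    unfolding F_def F'_def
    by (rule derivative_eq_intros deriv_time that refl | simp)+
       (simp add: power2_eq_square algebra_simps)
  have E: "((\<lambda>t. LINT x|lborel. F t x) has_real_derivative (LINT x|lborel. F' t x)) (at t within {0..T})"
    if "0 \<le> t" "t \<le> T" "0 < T" for t
    by (rule has_derivative_space_integral(1)[OF F F_deriv F0 that])
  show "continuous_on {0..T} (wave_mass a \<phi> v)"
    unfolding mass by (rule continuous_on_of_derivative_within[OF E])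
  assume t: "0 < t" "t < T"
  have F'0: "F' t x = 0" if "norm x > R" for x
    by (rule has_derivative_space_integral(2)[OF F F_deriv F0 _ _ _ that]) (use t in auto)
  have g0: "g i t x = 0" if "norm x > R" for i x
    using zero[of t x] that t by (auto simp: g_def)
  have hess_slice: "continuous_on UNIV (\<phi>xx i t)" for i
    using t by (intro future_continuous_slice hess_continuous) auto
  have g: "continuous_on UNIV (g i t)" "continuous_on UNIV (g' i t)" for i
    unfolding g_def g'_def using t
    by (intro continuous_intros continuous_slice hess_slice; simp)+
  have g_deriv: "((\<lambda>h. g i t (x + h *\<^sub>R axis i 1)) has_real_derivative g' i t x) (at 0)" for i x
    unfolding g_def g'_def using t
    by (auto intro!: derivative_eq_intros deriv_space hess simp: algebra_simps power2_eq_square)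
  note D = space_integral_partial_derivative_zero[OF g g_deriv g0]
  have Q: "Q t x = F' t x - (\<Sum>i\<in>UNIV. g' i t x)" for x
  proof -
    have "(\<Sum>i\<in>UNIV. g' i t x) = 2 * v t x * (\<phi>x t x \<bullet> grad (v t) x)
        + \<phi> t x * (norm (grad (v t) x))\<^sup>2 + \<phi> t x * v t x * (q t x + a x * p t x)
        + (v t x)\<^sup>2 * (\<Sum>i\<in>UNIV. \<phi>xx i t x) / 2"
      unfolding equation[OF t(1)] inner_grad norm_grad_square g'_def
      by (simp add: sum.distrib sum_distrib_left sum_distrib_right sum_divide_distrib algebra_simps)
    then show ?thesis
      unfolding Q_def F'_def by (simp add: algebra_simps)
  qed
  have int_F': "integrable lborel (F' t)"
    using t F(2) F'0
    by (intro integrable_compact_support[where R = R] future_continuous_slice) auto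
  have int_g': "integrable lborel (g' i t)" for i
    using D(2) g(2) by (intro integrable_compact_support[where R = R]) auto
  show "integrable lborel (Q t)"
    unfolding Q using int_F' int_g' by auto
  have "(LINT x|lborel. Q t x) = (LINT x|lborel. F' t x)"
    unfolding Q using int_F' int_g' D(1) by simp
  moreover have "at t within {0..T} = at t"
    using t by (intro at_within_interior) auto
  ultimately show "(wave_mass a \<phi> v has_real_derivative (LINT x|lborel. Q t x)) (at t)"
    using E[of t] t unfolding mass[abs_def] by simp
qed

end

section \<open>Finite speed of propagation\<close>

lemma norm_add_axis_square:
  fixes y :: "real^'n"
  shows "(norm (y + h *\<^sub>R axis i 1))\<^sup>2 = (norm y)\<^sup>2 + 2 * h * y $ i + h\<^sup>2"
proof -
  have "axis i 1 \<bullet> axis i (1::real) = 1" by (simp add: inner_axis)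
  then show ?thesis
    unfolding power2_norm_eq_inner
    by (simp add: inner_add_left inner_add_right inner_axis inner_commute[of "axis i 1" y]
        power2_eq_square algebra_simps)
qed

lemma has_partial_deriv_sqrt_norm:
  fixes y :: "real^'n"
  assumes "c > 0"
  shows "((\<lambda>h. sqrt (c + (norm (y + h *\<^sub>R axis i 1))\<^sup>2)) has_real_derivative
           y $ i / sqrt (c + (norm y)\<^sup>2)) (at 0)"
proof -
  have "c + (norm y)\<^sup>2 > 0" using assms by (simp add: add_pos_nonneg)
  then show ?thesis
    unfolding norm_add_axis_square
    by (auto intro!: derivative_eq_intros simp: divide_simps)
qed

lemma DERIV_positive_part_square:
  "((\<lambda>s. (max 0 s)\<^sup>2) has_real_derivative 2 * max 0 s) (at (s::real))"
proof -
  consider "s > 0" | "s < 0" | "s = 0" by linarith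
  then show ?thesis
  proof cases
    case 1
    have "((\<lambda>s. s\<^sup>2) has_real_derivative 2 * max 0 s) (at s)"
      using 1 by (auto intro!: derivative_eq_intros)
    then show ?thesis
      by (rule has_field_derivative_transform_within_open[of _ _ _ "{0<..}"]) (use 1 in auto)
  next
    case 2
    have "((\<lambda>s. 0) has_real_derivative 2 * max 0 s) (at s)"
      using 2 by (auto intro!: derivative_eq_intros)
    then show ?thesis
      by (rule has_field_derivative_transform_within_open[of _ _ _ "{..<0}"]) (use 2 in auto)
  next
    case 3
    have "((\<lambda>h. ((max 0 (0 + h))\<^sup>2 - (max 0 0)\<^sup>2) / h) \<longlongrightarrow> 0) (at (0::real))"
    proof (rule Lim_null_comparison)
      show "\<forall>\<^sub>F h in at 0. norm (((max 0 (0 + h))\<^sup>2 - (max 0 0)\<^sup>2) / h) \<le> \<bar>h::real\<bar>"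
        by (rule always_eventually) (auto simp: max_def power2_eq_square)
      show "((\<lambda>h. \<bar>h\<bar>) \<longlongrightarrow> 0) (at (0::real))"
        by (auto intro!: tendsto_eq_intros)
    qed
    then show ?thesis using 3 by (simp add: DERIV_def)
  qed
qed

lemma grad_eq_0_outside:
  assumes zero: "\<And>y. norm y > R \<Longrightarrow> f y = 0" and x: "norm x > R"
  shows "grad f x = 0"
proof -
  have "((\<lambda>h. f (x + h *\<^sub>R axis i 1)) has_real_derivative 0) (at 0)" for i
  proof (rule has_field_derivative_transform_within[where d = "norm x - R" and f = "\<lambda>_. 0"])
    show "0 = f (x + h *\<^sub>R axis i 1)" if "dist h 0 < norm x - R" for h
      using that norm_triangle_ineq2[of x "- h *\<^sub>R axis i 1"] zero[of "x + h *\<^sub>R axis i 1"] by simp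
  qed (use x in auto)
  then show ?thesis
    using partial_deriv_eqI[of f x _ 0] by (simp add: grad_def vec_eq_iff)
qed

lemma time_deriv_eq_0_outside:
  assumes zero: "\<And>t y. t \<ge> 0 \<Longrightarrow> norm y > L + t \<Longrightarrow> v t y = 0" and t: "t \<ge> 0" and x: "norm x > L + t"
  shows "time_deriv v t x = 0"
proof (rule time_deriv_eqI[OF t])
  show "((\<lambda>s. v s x) has_real_derivative 0) (at t within {0..})"
  proof (rule has_field_derivative_transform_within[where d = "norm x - L - t" and f = "\<lambda>_. 0"])
    show "0 = v s x" if "s \<in> {0..}" "dist s t < norm x - L - t" for s
      using that zero[of s x] by (auto simp: dist_real_def abs_less_iff)
  qed (use x t in auto)
qed

text \<open>
  The energy inside a backward light cone does not increase. The weight is the square of the positive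
  part of \<open>\<rho> - t - \<langle>x - x\<^sub>1\<rangle>\<^sub>\<eta>\<close>, where \<open>\<langle>y\<rangle>\<^sub>\<eta> = sqrt (\<eta>\<^sup>2 + |y|\<^sup>2)\<close> is a smooth substitute for \<open>|y|\<close>
  with gradient of length at most one.
\<close>

lemma finite_propagation_speed:
  fixes v :: "real \<Rightarrow> real^'n \<Rightarrow> real"
  assumes wave: "damped_wave a v" and a: "continuous_on UNIV a" "\<And>x. a x \<ge> 0"
    and v0: "\<And>x. norm x > L \<Longrightarrow> v 0 x = 0" and v1: "\<And>x. norm x > L \<Longrightarrow> time_deriv v 0 x = 0"
    and t1: "t1 \<ge> 0" and x1: "norm x1 > L + t1"
  shows "v t1 x1 = 0"
proof -
  \<comment> \<open>At \<open>t = 0\<close> the weight is positive only where \<open>|x - x1| < \<rho>\<close>, hence where the data vanish, and it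
    is positive at \<open>x1\<close> as long as \<open>t < \<rho> - \<eta>\<close>, where \<open>\<rho> - \<eta> = t1 + \<eta>\<close>.\<close>
  define \<eta> where "\<eta> = (norm x1 - L - t1) / 2"
  define \<rho> where "\<rho> = norm x1 - L"
  define b where "b = (\<lambda>x. sqrt (\<eta>\<^sup>2 + (norm (x - x1))\<^sup>2))"
  define m where "m = (\<lambda>t x. max 0 (\<rho> - b x - t))"
  define \<phi> where "\<phi> = (\<lambda>t x. (m t x)\<^sup>2)"
  define \<phi>t where "\<phi>t = (\<lambda>t x. - 2 * m t x)"
  define \<phi>x where "\<phi>x = (\<lambda>t x. (- 2 * m t x / b x) *\<^sub>R (x - x1))"
  have \<eta>: "\<eta> > 0" using x1 by (simp add: \<eta>_def)
  have b_pos: "b x > 0" and b_ge: "norm (x - x1) \<le> b x" for x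
    using \<eta> by (auto simp: b_def intro!: add_pos_nonneg real_le_rsqrt)
  have m_nonneg: "m t x \<ge> 0" for t x by (simp add: m_def)
  have cont_b: "continuous_on S (\<lambda>z. b (snd z))" for S :: "(real \<times> (real^'n)) set"
    unfolding b_def by (intro continuous_intros)
  have weight: "C1_weight \<phi> \<phi>t \<phi>x"
    unfolding C1_weight_def
  proof (intro conjI allI impI)
    show "future_continuous \<phi>" "future_continuous \<phi>t" "future_continuous \<phi>x"
      unfolding future_continuous_def \<phi>_def \<phi>t_def \<phi>x_def m_def
      by (intro continuous_intros cont_b; simp add: less_imp_neq[OF b_pos, symmetric])+
    show "((\<lambda>s. \<phi> s x) has_real_derivative \<phi>t t x) (at t within {0..})" for t x
    proof -
      have "((\<lambda>s. \<rho> - b x - s) has_real_derivative - 1) (at t within {0..})"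
        by (auto intro!: derivative_eq_intros)
      from DERIV_chain2[OF DERIV_positive_part_square this]
      show ?thesis by (simp add: \<phi>_def \<phi>t_def m_def)
    qed
    show "((\<lambda>h. \<phi> t (x + h *\<^sub>R axis i 1)) has_real_derivative \<phi>x t x $ i) (at 0)" for t x i
    proof -
      have "((\<lambda>h. b (x + h *\<^sub>R axis i 1)) has_real_derivative (x - x1) $ i / b x) (at 0)"
        using has_partial_deriv_sqrt_norm[of "\<eta>\<^sup>2" "x - x1" i] \<eta>
        by (simp add: b_def algebra_simps)
      then have "((\<lambda>h. \<rho> - b (x + h *\<^sub>R axis i 1) - t) has_real_derivative - ((x - x1) $ i / b x)) (at 0)"
        by (auto intro!: derivative_eq_intros)
      from DERIV_chain2[OF DERIV_positive_part_square this]
      show ?thesis by (simp add: \<phi>_def \<phi>x_def m_def)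
    qed
  qed
  interpret weighted_damped_wave a v \<phi> \<phi>t \<phi>x
    using wave a(1) weight by unfold_locales
  have near: "norm (x - x1) < \<rho>" if "\<phi> t x \<noteq> 0" "t \<ge> 0" for t x
    using that b_ge[of x] by (auto simp: \<phi>_def m_def max_def split: if_splits)
  have zero: "\<phi> t x = 0 \<or> (time_deriv v t x = 0 \<and> grad (v t) x = 0)"
    if "0 \<le> t" "norm x > \<rho> + norm x1" for t x
    using near[of t x] that norm_triangle_ineq2[of x x1] by fastforce
  note E = wave_energy_identity[of "t1 + 1" "\<rho> + norm x1", OF zero]
  let ?Q = "\<lambda>t x. \<phi>t t x * ((time_deriv v t x)\<^sup>2 + (norm (grad (v t) x))\<^sup>2) / 2
      - a x * \<phi> t x * (time_deriv v t x)\<^sup>2 - time_deriv v t x * (\<phi>x t x \<bullet> grad (v t) x)"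
  have nonpos: "?Q t x \<le> 0" for t x
  proof -
    let ?p = "time_deriv v t x" and ?w = "grad (v t) x"
    have "norm (\<phi>x t x) = 2 * m t x * (norm (x - x1) / b x)"
      using m_nonneg[of t x] b_pos[of x] by (simp add: \<phi>x_def abs_mult)
    also have "\<dots> \<le> 2 * m t x * 1"
      using b_ge[of x] b_pos[of x] m_nonneg by (intro mult_left_mono) auto
    finally have "\<bar>\<phi>x t x \<bullet> ?w\<bar> \<le> 2 * m t x * norm ?w"
      using Cauchy_Schwarz_ineq2[of "\<phi>x t x" ?w] mult_right_mono[of "norm (\<phi>x t x)" "2 * m t x" "norm ?w"]
      by simp
    then have "\<bar>?p\<bar> * \<bar>\<phi>x t x \<bullet> ?w\<bar> \<le> \<bar>?p\<bar> * (2 * m t x * norm ?w)"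
      by (intro mult_left_mono) auto
    then have "- ?p * (\<phi>x t x \<bullet> ?w) \<le> m t x * (2 * \<bar>?p\<bar> * norm ?w)"
      using abs_ge_minus_self[of "?p * (\<phi>x t x \<bullet> ?w)"] by (simp add: abs_mult mult_ac)
    also have "\<dots> \<le> m t x * (?p\<^sup>2 + (norm ?w)\<^sup>2)"
      using sum_squares_bound[of "\<bar>?p\<bar>" "norm ?w"] m_nonneg by (intro mult_left_mono) auto
    finally show ?thesis
      using mult_nonneg_nonneg[OF mult_nonneg_nonneg[OF a(2)[of x] zero_le_power2[of "m t x"]] zero_le_power2[of ?p]]
      by (simp add: \<phi>t_def \<phi>_def algebra_simps)
  qed
  have E0: "wave_energy \<phi> v 0 = 0"
  proof -
    have "\<phi> 0 x * ((time_deriv v 0 x)\<^sup>2 + (norm (grad (v 0) x))\<^sup>2) / 2 = 0" for x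
    proof (cases "\<phi> 0 x = 0")
      case False
      then have "norm x > L"
        using near[OF False] norm_triangle_ineq3[of x x1] by (simp add: \<rho>_def norm_minus_commute abs_less_iff)
      then show ?thesis using v1 grad_eq_0_outside[of L "v 0" x] v0 by simp
    qed simp
    then show ?thesis
      unfolding wave_energy_def by (simp only: Bochner_Integration.integral_zero)
  qed
  have "time_deriv v t x1 = 0" if t: "0 \<le> t" "t \<le> t1" for t
  proof (rule ccontr)
    assume nz: "time_deriv v t x1 \<noteq> 0"
    have "wave_energy \<phi> v t \<le> wave_energy \<phi> v 0"
    proof (rule DERIV_nonpos_imp_decreasing_open[OF t(1)])
      show "\<exists>D. (wave_energy \<phi> v has_real_derivative D) (at s) \<and> D \<le> 0" if "0 < s" "s < t" for s
      proof (intro exI conjI)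
        show "(wave_energy \<phi> v has_real_derivative (LINT x|lborel. ?Q s x)) (at s)"
          using E(3)[of s] that t by simp
        have "0 \<le> (LINT x|lborel. - ?Q s x)"
          using nonpos by (intro Bochner_Integration.integral_nonneg) simp
        then show "(LINT x|lborel. ?Q s x) \<le> 0"
          by (simp only: Bochner_Integration.integral_minus)
      qed
      show "continuous_on {0..t} (wave_energy \<phi> v)"
        using t by (intro continuous_on_subset[OF E(1)]) auto
    qed
    then have le0: "(LINT x|lborel. \<phi> t x * ((time_deriv v t x)\<^sup>2 + (norm (grad (v t) x))\<^sup>2) / 2) \<le> 0"
      using E0 by (simp add: wave_energy_def)
    have "continuous_on UNIV (\<lambda>x. \<phi> t x * ((time_deriv v t x)\<^sup>2 + (norm (grad (v t) x))\<^sup>2) / 2)"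
      using t by (intro continuous_intros continuous_slice
          future_continuous_slice[OF future_continuous_grad[OF smooth(1)]]) auto
    from nonneg_continuous_space_integral_zero[OF this _ _ le0, of "\<rho> + norm x1" x1]
    have "\<phi> t x1 * ((time_deriv v t x1)\<^sup>2 + (norm (grad (v t) x1))\<^sup>2) / 2 = 0"
      using zero[OF t(1)] by (fastforce simp: \<phi>_def)
    moreover have "\<phi> t x1 > 0"
    proof -
      have "b x1 = \<eta>" using \<eta> by (simp add: b_def)
      moreover have "\<rho> - \<eta> - t = \<eta> + (t1 - t)" by (simp add: \<rho>_def \<eta>_def field_simps)
      ultimately have "\<rho> - b x1 - t > 0" using t \<eta> by simp
      then show ?thesis by (simp add: \<phi>_def m_def)
    qed
    moreover have "(time_deriv v t x1)\<^sup>2 + (norm (grad (v t) x1))\<^sup>2 > 0"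
      using nz by (simp add: add_pos_nonneg)
    ultimately show False by simp
  qed
  then have "((\<lambda>s. time_deriv v s x1) has_integral 0) {0..t1}"
    by (intro has_integral_is_0) auto
  from has_integral_unique[OF time_deriv_integral[OF smooth(1) t1, of x1] this]
  have "v t1 x1 = v 0 x1" by simp
  moreover have "v 0 x1 = 0" using x1 t1 by (intro v0) simp
  ultimately show ?thesis by simp
qed

section \<open>The exponential weight\<close>

lemma bracket_ge_1: "bracket x \<ge> 1"
  by (simp add: bracket_def)

lemma bracket_pos [simp]: "bracket x > 0" "bracket x \<noteq> 0"
  using bracket_ge_1[of x] by linarith+

lemma bracket_le: "bracket x \<le> 1 + norm x"
  unfolding bracket_def by (rule real_le_lsqrt) (auto simp: power2_eq_square algebra_simps)

lemma norm_le_bracket: "norm x \<le> bracket x"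
  unfolding bracket_def by (rule real_le_rsqrt) simp

lemma continuous_on_bracket [continuous_intros]:
  "continuous_on S f \<Longrightarrow> continuous_on S (\<lambda>x. bracket (f x))"
  unfolding bracket_def by (intro continuous_intros)

lemma damping_pos: "damping \<alpha> x > 0"
  by (simp add: damping_def)

lemma damping_le_1: "\<alpha> \<ge> 0 \<Longrightarrow> damping \<alpha> x \<le> 1"
  unfolding damping_def using powr_mono[of "-\<alpha>" 0 "bracket x"] bracket_ge_1[of x] by simp

lemma continuous_on_damping: "continuous_on S (damping \<alpha>)"
  unfolding damping_def by (intro continuous_intros) auto

lemma has_partial_deriv_bracket_powr:
  fixes x :: "real^'n"
  shows "((\<lambda>h. bracket (x + h *\<^sub>R axis i 1) powr r) has_real_derivative
           r * bracket x powr (r - 2) * x $ i) (at 0)"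
proof -
  have "((\<lambda>h. bracket (x + h *\<^sub>R axis i 1)) has_real_derivative x $ i / bracket x) (at 0)"
    using has_partial_deriv_sqrt_norm[of 1 x i] by (simp add: bracket_def)
  from DERIV_powr[OF this _ DERIV_const[of r]]
  have "((\<lambda>h. bracket (x + h *\<^sub>R axis i 1) powr r) has_real_derivative
      bracket x powr r * (x $ i / bracket x * r / bracket x)) (at 0)"
    by simp
  moreover have "bracket x powr r = bracket x powr (r - 2) * (bracket x)\<^sup>2"
    by (simp flip: powr_realpow add: powr_add[symmetric])
  ultimately show ?thesis by (simp add: power2_eq_square mult_ac)
qed

text \<open>
  Closed forms of \<open>\<partial>\<^sub>t\<psi>\<close>, \<open>\<nabla>\<psi>\<close> and \<open>\<partial>\<^sub>i\<partial>\<^sub>i\<psi>\<close>, with powers of the bracket expressed by the damping.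
\<close>

definition weight_t :: "real \<Rightarrow> real \<Rightarrow> real \<Rightarrow> real^'n \<Rightarrow> real" where
  "weight_t \<alpha> \<delta> t x = - weight \<alpha> \<delta> t x / (1 + t)"

definition weight_x :: "real \<Rightarrow> real \<Rightarrow> real \<Rightarrow> real^'n \<Rightarrow> real^'n" where
  "weight_x \<alpha> \<delta> t x = (damping \<alpha> x / ((2 - \<alpha>) * (2 + \<delta>) * (1 + t))) *\<^sub>R x"

definition weight_xx :: "real \<Rightarrow> real \<Rightarrow> 'n \<Rightarrow> real \<Rightarrow> real^'n \<Rightarrow> real" where
  "weight_xx \<alpha> \<delta> i t x = (damping \<alpha> x - \<alpha> * bracket x powr (- \<alpha> - 2) * (x $ i)\<^sup>2)
      / ((2 - \<alpha>) * (2 + \<delta>) * (1 + t))"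

context
  fixes \<alpha> \<delta> :: real
  assumes \<alpha>: "0 \<le> \<alpha>" "\<alpha> < 1" and \<delta>: "0 < \<delta>"
begin

lemma has_time_deriv_weight:
  assumes "t \<ge> 0"
  shows "((\<lambda>s. weight \<alpha> \<delta> s x) has_real_derivative weight_t \<alpha> \<delta> t x) (at t within S)"
  unfolding weight_def weight_t_def using assms \<alpha> \<delta>
  by (auto intro!: derivative_eq_intros simp: divide_simps)

lemma has_partial_deriv_weight:
  assumes "t \<ge> 0"
  shows "((\<lambda>h. weight \<alpha> \<delta> t (x + h *\<^sub>R axis i 1)) has_real_derivative weight_x \<alpha> \<delta> t x $ i) (at 0)"
proof -
  have "1 / (e\<^sup>2 * c) * (e * d * y / \<tau>) = d / (e * c * \<tau>) * y" if "e \<noteq> 0" for e c d y \<tau> :: real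
    using that by (simp add: power2_eq_square)
  from this[of "2 - \<alpha>"]
  have "1 / ((2 - \<alpha>)\<^sup>2 * (2 + \<delta>)) * ((2 - \<alpha>) * bracket x powr (2 - \<alpha> - 2) * x $ i / (1 + t))
      = weight_x \<alpha> \<delta> t x $ i"
    unfolding weight_x_def damping_def using \<alpha> by simp
  moreover have "((\<lambda>h. weight \<alpha> \<delta> t (x + h *\<^sub>R axis i 1)) has_real_derivative
      1 / ((2 - \<alpha>)\<^sup>2 * (2 + \<delta>)) * ((2 - \<alpha>) * bracket x powr (2 - \<alpha> - 2) * x $ i / (1 + t))) (at 0)"
    unfolding weight_def by (intro DERIV_cmult DERIV_cdivide has_partial_deriv_bracket_powr)
  ultimately show ?thesis by simp
qed

lemma has_second_partial_deriv_weight: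
  assumes "t \<ge> 0"
  shows "((\<lambda>h. weight_x \<alpha> \<delta> t (x + h *\<^sub>R axis i 1) $ i) has_real_derivative weight_xx \<alpha> \<delta> i t x) (at 0)"
proof -
  have "((\<lambda>h. bracket (x + h *\<^sub>R axis i 1) powr (- \<alpha>) * (x $ i + h)) has_real_derivative
      (- \<alpha> * bracket x powr (- \<alpha> - 2) * x $ i) * (x $ i + 0) + 1 * bracket (x + 0 *\<^sub>R axis i 1) powr (- \<alpha>)) (at 0)"
    by (intro DERIV_mult has_partial_deriv_bracket_powr) (auto intro!: derivative_eq_intros)
  from DERIV_cdivide[OF this, of "(2 - \<alpha>) * (2 + \<delta>) * (1 + t)"]
  show ?thesis
    by (simp add: weight_x_def weight_xx_def damping_def power2_eq_square mult_ac)
qed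

lemma future_continuous_weight:
  "future_continuous (weight \<alpha> \<delta>)" "future_continuous (weight_t \<alpha> \<delta>)"
  "future_continuous (weight_x \<alpha> \<delta>)" "future_continuous (weight_xx \<alpha> \<delta> i)"
  unfolding future_continuous_def weight_t_def weight_def weight_x_def weight_xx_def damping_def
  using \<alpha> \<delta> by (intro continuous_intros; force)+

text \<open>
  The constant in the weight is chosen such that \<open>a |\<psi>\<^sub>t| \<ge> (2 + \<delta>) |\<nabla>\<psi>|\<^sup>2\<close>: the damping dominates
  the cross terms that the weight creates.
\<close>

lemma norm_weight_x_square_le:
  assumes "t \<ge> 0"
  shows "(2 + \<delta>) * (norm (weight_x \<alpha> \<delta> t x))\<^sup>2 \<le> damping \<alpha> x * - weight_t \<alpha> \<delta> t x"
proof -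
  let ?A = "1 / ((2 - \<alpha>)\<^sup>2 * (2 + \<delta>))"
  have A: "?A \<ge> 0" using \<delta> by simp
  have "c * (d / (e * c * \<tau>) * y)\<^sup>2 = 1 / (e\<^sup>2 * c) * ((d / \<tau>)\<^sup>2 * y\<^sup>2)" if "c \<noteq> 0" for e c d y \<tau> :: real
    using that by (simp add: power2_eq_square mult_ac)
  from this[of "2 + \<delta>"]
  have "(2 + \<delta>) * (norm (weight_x \<alpha> \<delta> t x))\<^sup>2 = ?A * ((damping \<alpha> x / (1 + t))\<^sup>2 * (norm x)\<^sup>2)"
    using \<alpha> \<delta> assms damping_pos[of \<alpha> x] by (simp add: weight_x_def)
  also have "\<dots> \<le> ?A * ((damping \<alpha> x / (1 + t))\<^sup>2 * (bracket x)\<^sup>2)"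
    by (intro mult_left_mono A power_mono norm_le_bracket) auto
  also have "\<dots> = damping \<alpha> x * - weight_t \<alpha> \<delta> t x"
  proof -
    have "bracket x powr (2 - \<alpha>) = damping \<alpha> x * (bracket x)\<^sup>2"
      unfolding damping_def by (simp flip: powr_realpow add: powr_add[symmetric])
    then show ?thesis
      by (simp add: weight_t_def weight_def power2_eq_square mult.assoc)
  qed
  finally show ?thesis .
qed

text \<open>The source of the decay rate: the coefficient of \<open>a / (1 + t)\<close> is the constant \<open>B\<close> of the introduction.\<close>

lemma laplacian_weight_ge:
  assumes "t \<ge> 0"
  shows "(real CARD('n) - \<alpha>) / ((2 - \<alpha>) * (2 + \<delta>)) * damping \<alpha> x / (1 + t)
    \<le> (\<Sum>i\<in>UNIV. weight_xx \<alpha> \<delta> i t (x :: real^'n))"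
proof -
  let ?d = "(2 - \<alpha>) * (2 + \<delta>) * (1 + t)"
  have d: "?d > 0" using \<alpha> \<delta> assms by simp
  have sq: "(\<Sum>i\<in>UNIV. (x $ i)\<^sup>2) = (norm x)\<^sup>2"
    unfolding power2_norm_eq_inner by (simp add: inner_vec_def power2_eq_square)
  have "bracket x powr (- \<alpha> - 2) * (norm x)\<^sup>2 \<le> bracket x powr (- \<alpha> - 2) * (bracket x)\<^sup>2"
    by (intro mult_left_mono power_mono norm_le_bracket) auto
  also have "\<dots> = damping \<alpha> x"
    unfolding damping_def by (simp flip: powr_realpow add: powr_add[symmetric])
  finally have "\<alpha> * (bracket x powr (- \<alpha> - 2) * (norm x)\<^sup>2) \<le> \<alpha> * damping \<alpha> x"
    using \<alpha> by (intro mult_left_mono)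
  then have "(real CARD('n) - \<alpha>) * damping \<alpha> x / ?d
      \<le> (real CARD('n) * damping \<alpha> x - \<alpha> * bracket x powr (- \<alpha> - 2) * (norm x)\<^sup>2) / ?d"
    using d by (intro divide_right_mono) (auto simp: algebra_simps)
  also have "\<dots> = (\<Sum>i\<in>UNIV. weight_xx \<alpha> \<delta> i t x)"
    by (simp add: weight_xx_def sum_subtractf sum_divide_distrib[symmetric] sum_distrib_left[symmetric] sq)
  finally show ?thesis by simp
qed

lemma weight_t_nonpos: "t \<ge> 0 \<Longrightarrow> weight_t \<alpha> \<delta> t x \<le> 0"
  using \<delta> by (simp add: weight_t_def weight_def)

abbreviation (input) "\<Phi> t x \<equiv> exp (2 * weight \<alpha> \<delta> t x)"

lemma C1_weight_exp:
  "C1_weight \<Phi> (\<lambda>t x. 2 * weight_t \<alpha> \<delta> t x * \<Phi> t x) (\<lambda>t x. (2 * \<Phi> t x) *\<^sub>R weight_x \<alpha> \<delta> t x)"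
  unfolding C1_weight_def future_continuous_def
  by (intro conjI allI impI continuous_intros future_continuous_weight[unfolded future_continuous_def])
     (auto intro!: derivative_eq_intros has_time_deriv_weight has_partial_deriv_weight)

lemma has_second_partial_deriv_exp_weight:
  assumes "t \<ge> 0"
  shows "((\<lambda>h. ((2 * \<Phi> t (x + h *\<^sub>R axis i 1)) *\<^sub>R weight_x \<alpha> \<delta> t (x + h *\<^sub>R axis i 1)) $ i) has_real_derivative
    \<Phi> t x * (4 * (weight_x \<alpha> \<delta> t x $ i)\<^sup>2 + 2 * weight_xx \<alpha> \<delta> i t x)) (at 0)"
  unfolding vector_scaleR_component
  by (auto intro!: derivative_eq_intros has_second_partial_deriv_weight[OF assms]
      has_partial_deriv_weight[OF assms] simp: power2_eq_square algebra_simps)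

lemma future_continuous_second_exp_weight:
  "future_continuous (\<lambda>t x. \<Phi> t x * (4 * (weight_x \<alpha> \<delta> t x $ i)\<^sup>2 + 2 * weight_xx \<alpha> \<delta> i t x))"
  unfolding future_continuous_def
  by (intro continuous_intros future_continuous_weight[unfolded future_continuous_def])

end

section \<open>The pointwise dissipation inequality\<close>

lemma le_sum_of_square_le:
  fixes P Q Z :: real
  assumes "P \<ge> 0" "Q \<ge> 0" "Z\<^sup>2 \<le> 4 * P * Q"
  shows "\<bar>Z\<bar> \<le> P + Q"
proof -
  have "Z\<^sup>2 \<le> (P + Q)\<^sup>2"
    using assms(3) zero_le_power2[of "P - Q"] by (simp add: power2_eq_square algebra_simps)
  then show ?thesis using assms(1,2) by (simp add: abs_le_square_iff[symmetric])
qed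

text \<open>
  The integrand of the derivative of the Lyapunov functional, divided by \<open>e\<^bsup>2\<psi>\<^esup> \<tau>\<^sup>M\<close>. The variables
  stand for the values at one point of \<open>v\<close> and its derivatives (\<open>p = v\<^sub>t\<close>, \<open>y = |\<nabla>v|\<close>), of the weight
  (\<open>s = - \<psi>\<^sub>t\<close>, \<open>g = |\<nabla>\<psi>|\<^sup>2\<close>, \<open>D = \<Delta>\<psi>\<close>, \<open>X = \<nabla>\<psi> \<cdot> \<nabla>v\<close>), of the damping \<open>a\<close> and of \<open>T = \<tau>\<^sup>\<alpha>\<close>; the number
  \<open>N\<close> is the small coefficient that comes from differentiating \<open>\<tau>\<^bsup>M + \<alpha>\<^esup>\<close>. Every mixed term is split by
  the inequality between the arithmetic and the geometric mean into parts that are absorbed by the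
  damping \<open>a p\<^sup>2\<close>, by the gradient, or by the terms with \<open>s\<close> and \<open>D\<close>.
\<close>

lemma dissipation_inequality:
  fixes p v y X a s g D \<tau> T \<mu> \<nu> M K B \<delta> N :: real
  assumes X: "X\<^sup>2 \<le> g * y\<^sup>2" and g: "0 \<le> g" "(2 + \<delta>) * g \<le> a * s" and s: "s \<ge> 0"
    and \<delta>: "\<delta> > 0" and a: "a > 0" and T: "T > 0" "1 \<le> a * T" and \<tau>: "\<tau> > 0"
    and D: "B * a / \<tau> \<le> D"
    and \<kappa>: "\<kappa> = K + B - M / 2" "\<kappa> > 0"
    and \<mu>: "\<mu> \<ge> 16" "\<mu> \<ge> 2 * (2 + \<delta>) / \<delta>"
    and N: "N \<le> \<delta> / (8 + \<delta>) / 2"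
    and \<nu>: "0 \<le> \<nu>" "\<nu> * (M + 1) \<le> \<delta> / (8 + \<delta>)"
    and M: "M\<^sup>2 / (4 * \<kappa>) * (T / \<tau>) \<le> 1"
  shows "N * (p\<^sup>2 + y\<^sup>2) + (\<mu> * T + \<nu> * \<tau>) * (- s * (p\<^sup>2 + y\<^sup>2) - a * p\<^sup>2 - 2 * p * X)
      + M / \<tau> * (v * p + a * v\<^sup>2 / 2)
      + (- 2 * s * v * p - s * a * v\<^sup>2 + p\<^sup>2 - y\<^sup>2 - 4 * v * X - 2 * g * v\<^sup>2 - D * v\<^sup>2)
      + \<nu> * (M + 1) / 2 * (p\<^sup>2 + y\<^sup>2)
    \<le> - \<nu> / 4 * \<tau> * (a * p\<^sup>2) + K / \<tau> * (a * v\<^sup>2)"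
proof -
  \<comment> \<open>\<open>\<theta>\<close> is chosen such that \<open>(1 - \<theta>) (2 + \<delta>) = 2 + \<delta> / 2\<close>: half of the surplus \<open>\<delta>\<close> keeps a
    multiple \<open>\<delta>1\<close> of the squared gradient, and the other half leaves \<open>\<theta> s a v\<^sup>2\<close> for the term \<open>s v p\<close>.\<close>
  define \<theta> where "\<theta> = \<delta> / (2 * (2 + \<delta>))"
  define \<delta>1 where "\<delta>1 = \<delta> / (8 + \<delta>)"
  have \<theta>: "\<theta> > 0" "\<theta> \<le> 1" using \<delta> by (auto simp: \<theta>_def)
  have \<delta>1: "\<delta>1 > 0" "\<delta>1 \<le> 1" using \<delta> by (auto simp: \<delta>1_def)
  have as: "a * s \<ge> 0" using a s by simp

  have energy: "- s * (p\<^sup>2 + y\<^sup>2) - a * p\<^sup>2 - 2 * p * X \<le> - s * p\<^sup>2 - a * p\<^sup>2 / 4"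
  proof -
    have "\<delta> * g \<ge> 0" using g \<delta> by simp
    then have "2 * g \<le> a * s" using g(2) unfolding distrib_right by linarith
    then have "2 * X\<^sup>2 \<le> a * s * y\<^sup>2"
      using X mult_right_mono[of "2 * g" "a * s" "y\<^sup>2"] by simp
    from mult_left_mono[OF this, of "2 * p\<^sup>2"]
    have "(2 * p * X)\<^sup>2 \<le> 4 * (3 / 4 * (a * p\<^sup>2)) * (2 / 3 * (s * y\<^sup>2))"
      by (simp add: power_mult_distrib algebra_simps)
    from le_sum_of_square_le[OF _ _ this]
    have "\<bar>2 * p * X\<bar> \<le> 3 / 4 * (a * p\<^sup>2) + 2 / 3 * (s * y\<^sup>2)" using a s by simp
    moreover have "s * y\<^sup>2 \<ge> 0" using s by simp
    ultimately show ?thesis by (simp add: algebra_simps abs_le_iff)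
  qed

  have mass: "- s * a * v\<^sup>2 - y\<^sup>2 - 4 * v * X - 2 * g * v\<^sup>2 \<le> - \<theta> * (s * a * v\<^sup>2) - \<delta>1 * y\<^sup>2"
  proof -
    have e: "(1 - \<theta>) * (2 + \<delta>) = 2 + \<delta> / 2" using \<delta> by (simp add: \<theta>_def field_simps)
    have "(1 - \<theta>) * ((2 + \<delta>) * g) \<le> (1 - \<theta>) * (a * s)"
      using g \<theta> by (intro mult_left_mono) auto
    then have "(2 + \<delta> / 2) * g \<le> (1 - \<theta>) * (a * s)"
      by (simp only: e mult.assoc[symmetric])
    from mult_right_mono[OF this, of "v\<^sup>2"]
    have 1: "(2 + \<delta> / 2) * (g * v\<^sup>2) \<le> (1 - \<theta>) * (s * a * v\<^sup>2)" by (simp add: mult_ac)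
    have e16: "4 * (4 + \<delta> / 2) * (1 - \<delta>1) = 16" using \<delta> by (simp add: \<delta>1_def field_simps)
    have "4 * ((4 + \<delta> / 2) * (g * v\<^sup>2)) * ((1 - \<delta>1) * y\<^sup>2)
        = (4 * (4 + \<delta> / 2) * (1 - \<delta>1)) * (v\<^sup>2 * (g * y\<^sup>2))"
      by (simp only: mult_ac)
    then have "4 * ((4 + \<delta> / 2) * (g * v\<^sup>2)) * ((1 - \<delta>1) * y\<^sup>2) = 16 * v\<^sup>2 * (g * y\<^sup>2)"
      unfolding e16 by simp
    moreover have "16 * v\<^sup>2 * X\<^sup>2 \<le> 16 * v\<^sup>2 * (g * y\<^sup>2)" using X by (intro mult_left_mono) auto
    moreover have "(4 * v * X)\<^sup>2 = 16 * v\<^sup>2 * X\<^sup>2" by (simp add: power_mult_distrib)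
    ultimately have "(4 * v * X)\<^sup>2 \<le> 4 * ((4 + \<delta> / 2) * (g * v\<^sup>2)) * ((1 - \<delta>1) * y\<^sup>2)"
      by linarith
    from le_sum_of_square_le[OF _ _ this]
    have "\<bar>4 * v * X\<bar> \<le> (4 + \<delta> / 2) * (g * v\<^sup>2) + (1 - \<delta>1) * y\<^sup>2" using g \<delta> \<delta>1 by simp
    with 1 show ?thesis by (simp add: algebra_simps abs_le_iff)
  qed

  \<comment> \<open>The damping may be small, so \<open>1 / a\<close> is replaced by \<open>T\<close>. This costs a term which the energy,
    with its factor \<open>\<mu> T\<close>, can pay.\<close>
  have cross: "- 2 * s * v * p \<le> \<theta> * (s * a * v\<^sup>2) + T * s * p\<^sup>2 / \<theta>"
  proof -
    have "4 * (s * v * p)\<^sup>2 * 1 \<le> 4 * (s * v * p)\<^sup>2 * (a * T)"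
      using T by (intro mult_left_mono) auto
    then have "(- 2 * s * v * p)\<^sup>2 \<le> 4 * (\<theta> * (s * a * v\<^sup>2)) * (T * s * p\<^sup>2 / \<theta>)"
      using \<theta> by (simp add: power_mult_distrib power2_eq_square mult_ac)
    from le_sum_of_square_le[OF _ _ this] show ?thesis
      using \<theta> s a T by (simp add: abs_le_iff)
  qed
  have "T * s * p\<^sup>2 / \<theta> \<le> \<mu> * (T * s * p\<^sup>2)"
  proof -
    have "1 / \<theta> \<le> \<mu>" using \<mu> by (simp add: \<theta>_def)
    from mult_right_mono[OF this, of "T * s * p\<^sup>2"] show ?thesis using T s by simp
  qed
  with cross have cross': "- 2 * s * v * p \<le> \<theta> * (s * a * v\<^sup>2) + \<mu> * (T * s * p\<^sup>2)" by simp

  have time: "M / \<tau> * (v * p) \<le> \<kappa> / \<tau> * (a * v\<^sup>2) + p\<^sup>2"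
  proof -
    have "(M / \<tau> * (v * p))\<^sup>2 * 1 \<le> (M / \<tau> * (v * p))\<^sup>2 * (a * T)"
      using T by (intro mult_left_mono) auto
    then have "(M / \<tau> * (v * p))\<^sup>2 \<le> 4 * (\<kappa> / \<tau> * (a * v\<^sup>2)) * (M\<^sup>2 / (4 * \<kappa>) * (T / \<tau>) * p\<^sup>2)"
      using \<kappa>(2) \<tau> by (simp add: power_mult_distrib power2_eq_square mult_ac)
    from le_sum_of_square_le[OF _ _ this]
    have "\<bar>M / \<tau> * (v * p)\<bar> \<le> \<kappa> / \<tau> * (a * v\<^sup>2) + M\<^sup>2 / (4 * \<kappa>) * (T / \<tau>) * p\<^sup>2"
      using \<kappa>(2) \<tau> a T by simp
    then have "M / \<tau> * (v * p) \<le> \<kappa> / \<tau> * (a * v\<^sup>2) + M\<^sup>2 / (4 * \<kappa>) * (T / \<tau>) * p\<^sup>2"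
      by (rule order_trans[OF abs_ge_self])
    also have "M\<^sup>2 / (4 * \<kappa>) * (T / \<tau>) * p\<^sup>2 \<le> 1 * p\<^sup>2"
      using M by (intro mult_right_mono) auto
    finally show ?thesis by simp
  qed

  \<comment> \<open>The Laplacian of the weight pays for the \<open>M / 2\<close> that comes from differentiating \<open>\<tau>\<^sup>M\<close> and for the
    \<open>\<kappa>\<close> spent on the mixed term above; what it cannot pay is \<open>K\<close>.\<close>
  have decay: "- D * v\<^sup>2 + M / \<tau> * (a * v\<^sup>2 / 2) + \<kappa> / \<tau> * (a * v\<^sup>2) \<le> K / \<tau> * (a * v\<^sup>2)"
  proof -
    have "B * a / \<tau> * v\<^sup>2 \<le> D * v\<^sup>2" using D by (intro mult_right_mono) auto
    moreover have "- (B * a / \<tau> * v\<^sup>2) + M / \<tau> * (a * v\<^sup>2 / 2) + \<kappa> / \<tau> * (a * v\<^sup>2) = K / \<tau> * (a * v\<^sup>2)"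
      using \<tau> unfolding \<kappa>(1) by (simp add: field_simps)
    ultimately show ?thesis by linarith
  qed

  have E: "(\<mu> * T + \<nu> * \<tau>) * (- s * (p\<^sup>2 + y\<^sup>2) - a * p\<^sup>2 - 2 * p * X)
      \<le> - \<mu> * (T * s * p\<^sup>2) - 4 * p\<^sup>2 - \<nu> / 4 * \<tau> * (a * p\<^sup>2)"
  proof -
    have "(\<mu> * T + \<nu> * \<tau>) * (- s * (p\<^sup>2 + y\<^sup>2) - a * p\<^sup>2 - 2 * p * X)
        \<le> (\<mu> * T + \<nu> * \<tau>) * (- s * p\<^sup>2 - a * p\<^sup>2 / 4)"
      using energy \<mu> \<nu> T \<tau> by (intro mult_left_mono) auto
    also have "\<dots> = - \<mu> * (T * s * p\<^sup>2) - \<nu> * \<tau> * (s * p\<^sup>2) - \<nu> / 4 * \<tau> * (a * p\<^sup>2) - \<mu> / 4 * (a * T) * p\<^sup>2"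
      by (simp add: field_simps)
    also have "\<dots> \<le> - \<mu> * (T * s * p\<^sup>2) - \<nu> / 4 * \<tau> * (a * p\<^sup>2) - 4 * p\<^sup>2"
    proof -
      have "4 * 1 \<le> \<mu> / 4 * (a * T)" using \<mu> T by (intro mult_mono) auto
      from mult_right_mono[OF this, of "p\<^sup>2"] have "4 * p\<^sup>2 \<le> \<mu> / 4 * (a * T) * p\<^sup>2" by simp
      moreover have "\<nu> * \<tau> * (s * p\<^sup>2) \<ge> 0" using \<nu> \<tau> s by simp
      ultimately show ?thesis by linarith
    qed
    finally show ?thesis by linarith
  qed
  have "N + \<nu> * (M + 1) / 2 \<le> \<delta>1" 
    using N \<nu>(2) unfolding \<delta>1_def[symmetric] by linarith
  from mult_right_mono[OF this, of "p\<^sup>2 + y\<^sup>2"]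
  have small: "N * (p\<^sup>2 + y\<^sup>2) + \<nu> * (M + 1) / 2 * (p\<^sup>2 + y\<^sup>2) \<le> p\<^sup>2 + \<delta>1 * y\<^sup>2"
    using mult_right_mono[OF \<delta>1(2), of "p\<^sup>2"] by (simp add: algebra_simps)
  have "p\<^sup>2 \<ge> 0" by simp
  moreover have "M / \<tau> * (v * p + a * v\<^sup>2 / 2) = M / \<tau> * (v * p) + M / \<tau> * (a * v\<^sup>2 / 2)"
    by (rule distrib_left)
  ultimately show ?thesis
    using E small decay time cross' mass by linarith
qed

section \<open>A Lyapunov functional\<close>

text \<open>
  Solutions are considered together with the support property of finite propagation speed, since both
  are inherited by time derivatives.
\<close>

definition supported_wave :: "real \<Rightarrow> real \<Rightarrow> (real \<Rightarrow> real^'n \<Rightarrow> real) \<Rightarrow> bool" where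
  "supported_wave \<alpha> L v \<longleftrightarrow> damped_wave (damping \<alpha>) v \<and> (\<forall>t\<ge>0. \<forall>x. norm x > L + t \<longrightarrow> v t x = 0)"

definition weighted_integral :: "real \<Rightarrow> real \<Rightarrow> real \<Rightarrow> (real^'n \<Rightarrow> real) \<Rightarrow> real" where
  "weighted_integral \<alpha> \<delta> t f = (LINT x|lborel. exp (2 * weight \<alpha> \<delta> t x) * f x)"

lemma supported_wave_time_deriv: "supported_wave \<alpha> L v \<Longrightarrow> supported_wave \<alpha> L (time_deriv v)"
  unfolding supported_wave_def using damped_wave_time_deriv time_deriv_eq_0_outside by blast

lemma supported_wave_smooth: "supported_wave \<alpha> L v \<Longrightarrow> future_smooth v"
  by (simp add: supported_wave_def damped_wave_def)

lemma supported_wave_eq_0: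
  assumes "supported_wave \<alpha> L v" "t \<ge> 0" "norm x > L + t"
  shows "v t x = 0" "time_deriv v t x = 0" "grad (v t) x = 0"
proof -
  show "v t x = 0" "time_deriv v t x = 0"
    using assms supported_wave_time_deriv[OF assms(1)] by (simp_all add: supported_wave_def)
  show "grad (v t) x = 0"
    using assms by (intro grad_eq_0_outside[of "L + t"]) (auto simp: supported_wave_def)
qed

context
  fixes \<alpha> \<delta> :: real
  assumes \<alpha>: "0 \<le> \<alpha>" "\<alpha> < 1" and \<delta>: "0 < \<delta>"
begin

lemma integrable_weighted:
  fixes f :: "real^'n \<Rightarrow> real"
  assumes "continuous_on UNIV f" "t \<ge> 0" "\<And>x. norm x > R \<Longrightarrow> f x = 0"
  shows "integrable lborel (\<lambda>x. exp (2 * weight \<alpha> \<delta> t x) * f x)"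
  using assms future_continuous_slice[OF future_continuous_weight(1)[OF \<alpha> \<delta>] assms(2)]
  by (intro integrable_compact_support[where R = R] continuous_intros) auto

lemma integrable_weighted_wave:
  fixes v :: "real \<Rightarrow> real^'n \<Rightarrow> real"
  assumes "supported_wave \<alpha> L v" "t \<ge> 0"
  shows "integrable lborel (\<lambda>x. exp (2 * weight \<alpha> \<delta> t x) * (damping \<alpha> x * (v t x)\<^sup>2))"
    and "integrable lborel (\<lambda>x. exp (2 * weight \<alpha> \<delta> t x) * (v t x)\<^sup>2)"
    and "integrable lborel (\<lambda>x. exp (2 * weight \<alpha> \<delta> t x) * (norm (grad (v t) x))\<^sup>2)"
    and "integrable lborel (\<lambda>x. exp (2 * weight \<alpha> \<delta> t x) * (v t x * time_deriv v t x))"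
  using supported_wave_eq_0[OF assms] assms(2)
  by (intro integrable_weighted[where R = "L + t"] continuous_intros continuous_on_damping
      future_continuous_slice[OF future_smooth_continuous] supported_wave_smooth[OF assms(1)]
      future_smooth_time_deriv future_continuous_slice[OF future_continuous_grad]; simp)+

lemma weighted_integral_nonneg: "(\<And>x. f x \<ge> 0) \<Longrightarrow> weighted_integral \<alpha> \<delta> t f \<ge> 0"
  unfolding weighted_integral_def by (intro Bochner_Integration.integral_nonneg) auto

text \<open>
  In the support of the solution \<open>\<langle>x\<rangle> \<le> t\<^sub>0 + t\<close>, so the damping is at least \<open>(t\<^sub>0 + t)\<^bsup>-\<alpha>\<^esup>\<close>.
\<close>

lemma damping_ge_on_support:
  assumes "norm (x::real^'n) \<le> L + t" "1 + L + t \<le> \<tau>"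
  shows "1 \<le> damping \<alpha> x * \<tau> powr \<alpha>"
proof -
  have "bracket x \<le> \<tau>" using bracket_le[of x] assms by simp
  then have "bracket x powr \<alpha> \<le> \<tau> powr \<alpha>" using \<alpha> by (intro powr_mono2) (auto simp: less_imp_le)
  then have "damping \<alpha> x * bracket x powr \<alpha> \<le> damping \<alpha> x * \<tau> powr \<alpha>"
    by (intro mult_left_mono) (auto simp: less_imp_le[OF damping_pos])
  then show ?thesis by (simp add: damping_def powr_minus)
qed

text \<open>
  Differentiate the coefficients of \<open>G\<close>, insert the two energy identities, and compare the integrands.
  Outside the support of the solution both sides vanish; inside it the damping is at least \<open>\<tau>\<^bsup>-\<alpha>\<^esup>\<close>.
\<close>

lemma lyapunov_functional_derivative:
  fixes v :: "real \<Rightarrow> real^'n \<Rightarrow> real" and L M K t0 \<mu> \<nu> \<kappa> :: real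
  defines "B \<equiv> (real CARD('n) - \<alpha>) / ((2 - \<alpha>) * (2 + \<delta>))"
  assumes sol: "supported_wave \<alpha> L v" and L: "L > 0" and M: "M > 0" and K: "K \<ge> 0"
    and \<kappa>: "\<kappa> = K + B - M / 2" "\<kappa> > 0"
    and \<mu>: "\<mu> \<ge> 16" "\<mu> \<ge> 2 * (2 + \<delta>) / \<delta>"
    and \<nu>: "\<nu> > 0" "\<nu> * (M + 1) \<le> \<delta> / (8 + \<delta>)"
    and t0: "t0 \<ge> 1 + L" "\<mu> * (M + \<alpha>) * t0 powr (\<alpha> - 1) \<le> \<delta> / (8 + \<delta>)"
      "M\<^sup>2 / (4 * \<kappa>) * t0 powr (\<alpha> - 1) \<le> 1"
  defines "G \<equiv> \<lambda>t. (\<mu> * (t0 + t) powr (M + \<alpha>) + \<nu> * (t0 + t) powr (M + 1))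
        * wave_energy (\<lambda>t x. exp (2 * weight \<alpha> \<delta> t x)) v t
      + (t0 + t) powr M * wave_mass (damping \<alpha>) (\<lambda>t x. exp (2 * weight \<alpha> \<delta> t x)) v t"
  shows "continuous_on {0..T'} G"
    and "t > 0 \<Longrightarrow> \<exists>D. (G has_real_derivative D) (at t) \<and>
      D \<le> - (\<nu> / 4 * (t0 + t) powr (M + 1)
            * weighted_integral \<alpha> \<delta> t (\<lambda>x. damping \<alpha> x * (time_deriv v t x)\<^sup>2))
        + K * (t0 + t) powr (M - 1) * weighted_integral \<alpha> \<delta> t (\<lambda>x. damping \<alpha> x * (v t x)\<^sup>2)"
proof -
  let ?\<phi> = "\<lambda>t x. exp (2 * weight \<alpha> \<delta> t (x::real^'n))"
  let ?\<psi>t = "weight_t \<alpha> \<delta> :: real \<Rightarrow> real^'n \<Rightarrow> real" and ?\<psi>x = "weight_x \<alpha> \<delta> :: real \<Rightarrow> real^'n \<Rightarrow> real^'n"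
  let ?a = "damping \<alpha> :: real^'n \<Rightarrow> real"
  let ?p = "time_deriv v" and ?w = "\<lambda>t. grad (v t)"
  interpret weighted_damped_wave ?a v ?\<phi> "\<lambda>t x. 2 * ?\<psi>t t x * ?\<phi> t x" "\<lambda>t x. (2 * ?\<phi> t x) *\<^sub>R ?\<psi>x t x"
    using sol continuous_on_damping C1_weight_exp[OF \<alpha> \<delta>]
    by unfold_locales (auto simp: supported_wave_def)
  have zeroE: "?\<phi> t x = 0 \<or> (time_deriv v t x = 0 \<and> grad (v t) x = 0)"
    and zeroM: "v t x = 0"
    if "0 \<le> t" "t \<le> T" "norm x > L + T" for T t x
    using supported_wave_eq_0[OF sol that(1), of x] that by simp_all
  have powr_deriv: "((\<lambda>t. (t0 + t) powr r) has_real_derivative r * (t0 + t) powr (r - 1)) (at t)"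
    if "t \<ge> 0" for r t
    using that t0 L by (auto intro!: derivative_eq_intros)
  show "continuous_on {0..T'} G"
    unfolding G_def
  proof (intro continuous_intros)
    show "continuous_on {0..T'} (wave_energy ?\<phi> v)"
      by (rule wave_energy_identity(1)[where R = "L + T'"], erule (2) zeroE)
    show "continuous_on {0..T'} (wave_mass ?a ?\<phi> v)"
      by (rule wave_mass_identity(1)[where R = "L + T'", OF _ has_second_partial_deriv_exp_weight[OF \<alpha> \<delta>]
            future_continuous_second_exp_weight[OF \<alpha> \<delta>]], erule (2) zeroM)
  qed (use t0 L in auto)
  assume t: "t > 0"
  define \<tau> where "\<tau> = t0 + t"
  define S where "S = \<tau> powr M"
  define T where "T = \<tau> powr \<alpha>"
  have \<tau>: "\<tau> > 0" "1 + L + t \<le> \<tau>" "t0 \<le> \<tau>" "t0 > 0" using t t0 L by (auto simp: \<tau>_def)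
  have S: "S > 0" and T: "T > 0" using \<tau> by (auto simp: S_def T_def)
  have powrs: "\<tau> powr (M + \<alpha>) = S * T" "\<tau> powr (M + \<alpha> - 1) = S * (T / \<tau>)"
    "\<tau> powr (M + 1) = S * \<tau>" "\<tau> powr (M - 1) = S / \<tau>" "\<tau> powr (\<alpha> - 1) = T / \<tau>"
    using \<tau> by (simp_all add: S_def T_def powr_add powr_diff)
  have "T / \<tau> \<le> t0 powr (\<alpha> - 1)"
    unfolding powrs(5)[symmetric] using \<tau> \<alpha> by (intro powr_mono2') auto
  then have "\<mu> * (M + \<alpha>) * (T / \<tau>) \<le> \<mu> * (M + \<alpha>) * t0 powr (\<alpha> - 1)"
    and "M\<^sup>2 / (4 * \<kappa>) * (T / \<tau>) \<le> M\<^sup>2 / (4 * \<kappa>) * t0 powr (\<alpha> - 1)"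
    using \<mu> M \<alpha> \<kappa>(2) by (intro mult_left_mono; simp)+
  note R = order_trans[OF this(1) t0(2)] order_trans[OF this(2) t0(3)]

  let ?e = "\<lambda>x. ?\<phi> t x * ((?p t x)\<^sup>2 + (norm (?w t x))\<^sup>2) / 2"
  let ?h = "\<lambda>x. ?\<phi> t x * (v t x * ?p t x + ?a x * (v t x)\<^sup>2 / 2)"
  let ?E' = "\<lambda>x. 2 * ?\<psi>t t x * ?\<phi> t x * ((?p t x)\<^sup>2 + (norm (?w t x))\<^sup>2) / 2
      - ?a x * ?\<phi> t x * (?p t x)\<^sup>2 - ?p t x * (((2 * ?\<phi> t x) *\<^sub>R ?\<psi>x t x) \<bullet> ?w t x)"
  let ?H' = "\<lambda>x. 2 * ?\<psi>t t x * ?\<phi> t x * (v t x * ?p t x + ?a x * (v t x)\<^sup>2 / 2)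
      + ?\<phi> t x * ((?p t x)\<^sup>2 - (norm (?w t x))\<^sup>2)
      - 2 * v t x * (((2 * ?\<phi> t x) *\<^sub>R ?\<psi>x t x) \<bullet> ?w t x)
      - (v t x)\<^sup>2 * (\<Sum>i\<in>UNIV. ?\<phi> t x * (4 * (?\<psi>x t x $ i)\<^sup>2 + 2 * weight_xx \<alpha> \<delta> i t x)) / 2"
  have E': "(wave_energy ?\<phi> v has_real_derivative (LINT x|lborel. ?E' x)) (at t)" "integrable lborel ?E'"
    by (rule wave_energy_identity(2,3)[where T = "t + 1" and R = "L + (t + 1)"],
        erule (2) zeroE, use t in simp, use t in simp)+
  have H': "(wave_mass ?a ?\<phi> v has_real_derivative (LINT x|lborel. ?H' x)) (at t)" "integrable lborel ?H'"
    by (rule wave_mass_identity(2,3)[where T = "t + 1" and R = "L + (t + 1)",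
          OF _ has_second_partial_deriv_exp_weight[OF \<alpha> \<delta>] future_continuous_second_exp_weight[OF \<alpha> \<delta>]],
        erule (2) zeroM, assumption, use t in simp, use t in simp)+
  note int = integrable_weighted_wave[OF sol less_imp_le[OF t]]
    integrable_weighted_wave[OF supported_wave_time_deriv[OF sol] less_imp_le[OF t]]
  have int_e: "integrable lborel ?e" and int_h: "integrable lborel ?h"
    using Bochner_Integration.integrable_add[OF int(6) int(3)]
      Bochner_Integration.integrable_add[OF int(4) Bochner_Integration.integrable_divide[OF int(1), of 2]]
    by (simp_all add: distrib_left)

  define N where "N = \<mu> * (M + \<alpha>) * (T / \<tau>) / 2"
  let ?f = "\<lambda>x. (\<mu> * (M + \<alpha>) * (T / \<tau>) + \<nu> * (M + 1)) * ?e x + (\<mu> * T + \<nu> * \<tau>) * ?E' x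
      + M / \<tau> * ?h x + ?H' x"
  let ?b = "\<lambda>x. - \<nu> / 4 * \<tau> * (?\<phi> t x * (?a x * (?p t x)\<^sup>2)) + K / \<tau> * (?\<phi> t x * (?a x * (v t x)\<^sup>2))"
  have le: "?f x \<le> ?b x" for x
  proof (cases "norm x \<le> L + t")
    case False
    then show ?thesis
      using supported_wave_eq_0[OF sol less_imp_le[OF t], of x] by simp
  next
    case True
    define X where "X = ?\<psi>x t x \<bullet> ?w t x"
    define g where "g = (norm (?\<psi>x t x))\<^sup>2"
    define D where "D = (\<Sum>i\<in>UNIV. weight_xx \<alpha> \<delta> i t x)"
    have X: "X\<^sup>2 \<le> g * (norm (?w t x))\<^sup>2"
      using Cauchy_Schwarz_ineq[of "?\<psi>x t x" "?w t x"]
      by (simp add: X_def g_def power2_norm_eq_inner)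
    have D: "B * ?a x / \<tau> \<le> D"
    proof -
      have "B \<ge> 0"
      proof -
        have "real CARD('n) \<ge> 1" using one_le_card_finite[where 'a = 'n] by linarith
        then have "real CARD('n) - \<alpha> \<ge> 0" using \<alpha> by linarith
        then show ?thesis unfolding B_def by (rule divide_nonneg_pos) (use \<alpha> \<delta> in simp)
      qed
      then have "B * ?a x / \<tau> \<le> B * ?a x / (1 + t)"
        using \<tau> L t damping_pos[of \<alpha> x] by (intro divide_left_mono mult_nonneg_nonneg mult_pos_pos) auto
      also have "\<dots> \<le> D"
        using laplacian_weight_ge[OF \<alpha> \<delta> less_imp_le[OF t], of x] by (simp add: B_def D_def)
      finally show ?thesis .
    qed
    have sum: "(\<Sum>i\<in>UNIV. ?\<phi> t x * (4 * (?\<psi>x t x $ i)\<^sup>2 + 2 * weight_xx \<alpha> \<delta> i t x))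
        = ?\<phi> t x * (4 * g + 2 * D)"
      unfolding g_def D_def power2_norm_eq_inner
      by (simp add: inner_vec_def power2_eq_square sum.distrib flip: sum_distrib_left)
    let ?q = "N * ((?p t x)\<^sup>2 + (norm (?w t x))\<^sup>2)
      + (\<mu> * T + \<nu> * \<tau>) * (- (- ?\<psi>t t x) * ((?p t x)\<^sup>2 + (norm (?w t x))\<^sup>2) - ?a x * (?p t x)\<^sup>2 - 2 * ?p t x * X)
      + M / \<tau> * (v t x * ?p t x + ?a x * (v t x)\<^sup>2 / 2)
      + (- 2 * (- ?\<psi>t t x) * v t x * ?p t x - (- ?\<psi>t t x) * ?a x * (v t x)\<^sup>2 + (?p t x)\<^sup>2
        - (norm (?w t x))\<^sup>2 - 4 * v t x * X - 2 * g * (v t x)\<^sup>2 - D * (v t x)\<^sup>2)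
      + \<nu> * (M + 1) / 2 * ((?p t x)\<^sup>2 + (norm (?w t x))\<^sup>2)"
    have "?q \<le> - \<nu> / 4 * \<tau> * (?a x * (?p t x)\<^sup>2) + K / \<tau> * (?a x * (v t x)\<^sup>2)"
    proof (rule dissipation_inequality[where \<kappa> = \<kappa> and \<delta> = \<delta> and B = B and T = T and a = "?a x", OF X])
      show "(2 + \<delta>) * g \<le> ?a x * - ?\<psi>t t x"
        using norm_weight_x_square_le[OF \<alpha> \<delta> less_imp_le[OF t]] by (simp add: g_def)
      show "1 \<le> ?a x * T"
        unfolding T_def using True \<tau> by (intro damping_ge_on_support) auto
      show "N \<le> \<delta> / (8 + \<delta>) / 2"
        unfolding N_def using R(1) by (rule divide_right_mono) simp
    qed (use \<delta> \<kappa> \<mu> \<nu> R \<tau> T D damping_pos[of \<alpha> x] weight_t_nonpos[OF \<alpha> \<delta> less_imp_le[OF t], of x]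
        in \<open>auto simp: g_def\<close>)
    from mult_left_mono[OF this, of "?\<phi> t x"]
    have "?\<phi> t x * ?q \<le> ?b x"
      by (simp add: algebra_simps)
    moreover have "?f x = ?\<phi> t x * ?q"
      unfolding sum inner_scaleR_left X_def[symmetric] N_def using \<tau>(1) by (simp add: field_simps)
    ultimately show ?thesis by simp
  qed

  have linear: "(LINT x|lborel. c1 * f1 x + c2 * f2 x + c3 * f3 x + f4 x) = c1 * (LINT x|lborel. f1 x)
      + c2 * (LINT x|lborel. f2 x) + c3 * (LINT x|lborel. f3 x) + (LINT x|lborel. f4 x)"
    if "integrable lborel f1" "integrable lborel f2" "integrable lborel f3" "integrable lborel f4"
    for c1 c2 c3 and f1 f2 f3 f4 :: "real^'n \<Rightarrow> real"
    using that by simp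
  define e h e' h' where "e = wave_energy ?\<phi> v t" and "h = wave_mass ?a ?\<phi> v t"
    and "e' = (LINT x|lborel. ?E' x)" and "h' = (LINT x|lborel. ?H' x)"
  have "(G has_real_derivative
      ((\<mu> * ((M + \<alpha>) * (t0 + t) powr (M + \<alpha> - 1)) + \<nu> * ((M + 1) * (t0 + t) powr (M + 1 - 1))) * e
        + e' * (\<mu> * (t0 + t) powr (M + \<alpha>) + \<nu> * (t0 + t) powr (M + 1)))
      + (M * (t0 + t) powr (M - 1) * h + h' * (t0 + t) powr M)) (at t)"
    unfolding G_def e_def h_def e'_def h'_def using t
    by (intro DERIV_add DERIV_mult DERIV_cmult powr_deriv E'(1) H'(1)) auto
  also have "((\<mu> * ((M + \<alpha>) * (t0 + t) powr (M + \<alpha> - 1)) + \<nu> * ((M + 1) * (t0 + t) powr (M + 1 - 1))) * e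
        + e' * (\<mu> * (t0 + t) powr (M + \<alpha>) + \<nu> * (t0 + t) powr (M + 1)))
      + (M * (t0 + t) powr (M - 1) * h + h' * (t0 + t) powr M)
    = S * ((\<mu> * (M + \<alpha>) * (T / \<tau>) + \<nu> * (M + 1)) * e + (\<mu> * T + \<nu> * \<tau>) * e' + M / \<tau> * h + h')"
    unfolding \<tau>_def[symmetric] powrs add_diff_cancel_right' S_def[symmetric] by (simp add: algebra_simps add_divide_distrib)
  also have "(\<mu> * (M + \<alpha>) * (T / \<tau>) + \<nu> * (M + 1)) * e + (\<mu> * T + \<nu> * \<tau>) * e' + M / \<tau> * h + h'
      = (LINT x|lborel. ?f x)"
    unfolding e_def h_def e'_def h'_def wave_energy_def wave_mass_def
    by (rule linear[OF int_e E'(2) int_h H'(2), symmetric])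
  finally have deriv: "(G has_real_derivative S * (LINT x|lborel. ?f x)) (at t)" .
  have "(LINT x|lborel. ?f x) \<le> (LINT x|lborel. ?b x)"
    by (intro integral_mono le Bochner_Integration.integrable_add integrable_mult_right
        int_e E'(2) int_h H'(2) int(1,5))
  also have "\<dots> = - \<nu> / 4 * \<tau> * weighted_integral \<alpha> \<delta> t (\<lambda>x. ?a x * (?p t x)\<^sup>2)
      + K / \<tau> * weighted_integral \<alpha> \<delta> t (\<lambda>x. ?a x * (v t x)\<^sup>2)"
    unfolding weighted_integral_def using int(1,5) by simp
  finally have "S * (LINT x|lborel. ?f x)
      \<le> S * (- \<nu> / 4 * \<tau> * weighted_integral \<alpha> \<delta> t (\<lambda>x. ?a x * (?p t x)\<^sup>2)
        + K / \<tau> * weighted_integral \<alpha> \<delta> t (\<lambda>x. ?a x * (v t x)\<^sup>2))"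
    using S by (intro mult_left_mono) auto
  also have "\<dots> = - (\<nu> / 4 * \<tau> powr (M + 1) * weighted_integral \<alpha> \<delta> t (\<lambda>x. ?a x * (?p t x)\<^sup>2))
      + K * \<tau> powr (M - 1) * weighted_integral \<alpha> \<delta> t (\<lambda>x. ?a x * (v t x)\<^sup>2)"
    unfolding powrs by (simp add: algebra_simps)
  finally have bound: "S * (LINT x|lborel. ?f x)
      \<le> - (\<nu> / 4 * \<tau> powr (M + 1) * weighted_integral \<alpha> \<delta> t (\<lambda>x. ?a x * (?p t x)\<^sup>2))
      + K * \<tau> powr (M - 1) * weighted_integral \<alpha> \<delta> t (\<lambda>x. ?a x * (v t x)\<^sup>2)" .
  show "\<exists>D. (G has_real_derivative D) (at t) \<and>
      D \<le> - (\<nu> / 4 * (t0 + t) powr (M + 1) * weighted_integral \<alpha> \<delta> t (\<lambda>x. ?a x * (?p t x)\<^sup>2))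
        + K * (t0 + t) powr (M - 1) * weighted_integral \<alpha> \<delta> t (\<lambda>x. ?a x * (v t x)\<^sup>2)"
    unfolding \<tau>_def[symmetric] by (rule exI, rule conjI, rule deriv, rule bound)
qed

end

context
  fixes \<alpha> \<delta> :: real
  assumes \<alpha>: "0 \<le> \<alpha>" "\<alpha> < 1" and \<delta>: "0 < \<delta>"
begin

abbreviation (input) "W t f \<equiv> weighted_integral \<alpha> \<delta> t f"

text \<open>
  The functional is comparable to what it is meant to control: on the support \<open>1 / a \<le> \<tau>\<^sup>\<alpha>\<close>, so that the
  mixed term \<open>v v\<^sub>t\<close> is bounded by a quarter of \<open>a v\<^sup>2\<close> plus \<open>\<tau>\<^sup>\<alpha> v\<^sub>t\<^sup>2\<close>, which is a part of the energy term.
\<close>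

lemma lyapunov_functional_bounds:
  fixes v :: "real \<Rightarrow> real^'n \<Rightarrow> real" and L M t0 \<mu> \<nu> :: real
  assumes sol: "supported_wave \<alpha> L v" and L: "L > 0" and \<mu>: "\<mu> \<ge> 2" and \<nu>: "\<nu> \<ge> 0"
    and t: "t \<ge> 0" and t0: "t0 \<ge> 1 + L"
  defines "\<tau> \<equiv> t0 + t"
  defines "G \<equiv> (\<mu> * \<tau> powr (M + \<alpha>) + \<nu> * \<tau> powr (M + 1))
        * wave_energy (\<lambda>t x. exp (2 * weight \<alpha> \<delta> t x)) v t
      + \<tau> powr M * wave_mass (damping \<alpha>) (\<lambda>t x. exp (2 * weight \<alpha> \<delta> t x)) v t"
  defines "P \<equiv> W t (\<lambda>x. (time_deriv v t x)\<^sup>2)" and "Y \<equiv> W t (\<lambda>x. (norm (grad (v t) x))\<^sup>2)"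
    and "V \<equiv> W t (\<lambda>x. damping \<alpha> x * (v t x)\<^sup>2)"
  shows "\<tau> powr M / 4 * V + \<nu> / 2 * \<tau> powr (M + 1) * Y \<le> G"
    and "G \<le> (\<mu> * \<tau> powr (M + \<alpha>) + \<nu> * \<tau> powr (M + 1) + \<tau> powr (M + \<alpha>)) * (P + Y) + \<tau> powr M * V"
proof -
  let ?\<phi> = "\<lambda>x. exp (2 * weight \<alpha> \<delta> t (x::real^'n))"
  define Z where "Z = W t (\<lambda>x. v t x * time_deriv v t x)"
  define S where "S = \<tau> powr M"
  define T where "T = \<tau> powr \<alpha>"
  have \<tau>: "\<tau> > 0" "1 + L + t \<le> \<tau>" using t t0 L by (auto simp: \<tau>_def)
  have S: "S > 0" and T: "T > 0" using \<tau> by (auto simp: S_def T_def)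
  have powrs: "\<tau> powr (M + \<alpha>) = S * T" "\<tau> powr (M + 1) = S * \<tau>"
    using \<tau> by (simp_all add: S_def T_def powr_add)
  note int = integrable_weighted_wave[OF \<alpha> \<delta> sol t]
    integrable_weighted_wave[OF \<alpha> \<delta> supported_wave_time_deriv[OF sol] t]
  have nonneg: "P \<ge> 0" "Y \<ge> 0" "V \<ge> 0"
    unfolding P_def Y_def V_def
    by (intro weighted_integral_nonneg[OF \<alpha> \<delta>]; simp add: less_imp_le[OF damping_pos])+
  have energy: "wave_energy (\<lambda>t x. exp (2 * weight \<alpha> \<delta> t x)) v t = (P + Y) / 2"
    unfolding wave_energy_def P_def Y_def weighted_integral_def using int(3,6)
    by (simp add: distrib_left)
  have mass: "wave_mass (damping \<alpha>) (\<lambda>t x. exp (2 * weight \<alpha> \<delta> t x)) v t = Z + V / 2"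
  proof -
    have "?\<phi> x * (v t x * time_deriv v t x + damping \<alpha> x * (v t x)\<^sup>2 / 2)
        = ?\<phi> x * (v t x * time_deriv v t x) + ?\<phi> x * (damping \<alpha> x * (v t x)\<^sup>2) / 2" for x
      by (simp add: distrib_left)
    then show ?thesis
      unfolding wave_mass_def Z_def V_def weighted_integral_def using int(1,4) by simp
  qed
  have cross: "\<bar>v t x * time_deriv v t x\<bar> \<le> damping \<alpha> x * (v t x)\<^sup>2 / 4 + T * (time_deriv v t x)\<^sup>2" for x
  proof (cases "norm x \<le> L + t")
    case True
    then have "1 \<le> damping \<alpha> x * T"
      unfolding T_def using \<tau> by (intro damping_ge_on_support[OF \<alpha> \<delta>]) auto
    from mult_left_mono[OF this, of "(v t x * time_deriv v t x)\<^sup>2"]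
    have "(v t x * time_deriv v t x)\<^sup>2 \<le> 4 * (damping \<alpha> x * (v t x)\<^sup>2 / 4) * (T * (time_deriv v t x)\<^sup>2)"
      by (simp add: power_mult_distrib mult_ac)
    then show ?thesis
      using T damping_pos[of \<alpha> x] by (intro le_sum_of_square_le) auto
  next
    case False
    then show ?thesis using supported_wave_eq_0[OF sol t, of x] by simp
  qed
  have "\<bar>Z\<bar> \<le> V / 4 + T * P"
  proof -
    have "\<bar>Z\<bar> \<le> (LINT x|lborel. \<bar>?\<phi> x * (v t x * time_deriv v t x)\<bar>)"
      unfolding Z_def weighted_integral_def by (rule integral_abs_bound)
    also have "\<dots> \<le> (LINT x|lborel. ?\<phi> x * (damping \<alpha> x * (v t x)\<^sup>2) / 4 + T * (?\<phi> x * (time_deriv v t x)\<^sup>2))"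
    proof (intro integral_mono)
      show "\<bar>?\<phi> x * (v t x * time_deriv v t x)\<bar>
          \<le> ?\<phi> x * (damping \<alpha> x * (v t x)\<^sup>2) / 4 + T * (?\<phi> x * (time_deriv v t x)\<^sup>2)" for x
        using mult_left_mono[OF cross[of x], of "?\<phi> x"] by (simp add: abs_mult distrib_left mult_ac)
    qed (use int in auto)
    also have "\<dots> = V / 4 + T * P"
      unfolding V_def P_def weighted_integral_def using int(1,6) by simp
    finally show ?thesis .
  qed
  then have Z: "- (V / 4 + T * P) \<le> Z" "Z \<le> V / 4 + T * P" by linarith+
  have G: "G = S * ((\<mu> * T + \<nu> * \<tau>) * ((P + Y) / 2) + (Z + V / 2))"
    unfolding G_def energy mass powrs S_def[symmetric] by (simp add: algebra_simps add_divide_distrib)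
  have "T * P \<le> \<mu> / 2 * (T * P)" "0 \<le> \<mu> / 2 * (T * Y)" "0 \<le> \<nu> * \<tau> * P / 2" "0 \<le> \<nu> * \<tau> * Y / 2" "0 \<le> T * Y"
    using mult_right_mono[of 1 "\<mu> / 2" "T * P"] \<mu> \<nu> \<tau> T nonneg by simp_all
  note terms = this
  have exp: "(\<mu> * T + \<nu> * \<tau>) * ((P + Y) / 2)
      = \<mu> / 2 * (T * P) + \<mu> / 2 * (T * Y) + \<nu> * \<tau> * P / 2 + \<nu> * \<tau> * Y / 2"
    by (simp add: field_simps)
  have "V / 4 + \<nu> / 2 * \<tau> * Y \<le> (\<mu> * T + \<nu> * \<tau>) * ((P + Y) / 2) + (Z + V / 2)"
  proof -
    have "\<nu> / 2 * \<tau> * Y = \<nu> * \<tau> * Y / 2" by simp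
    then show ?thesis unfolding exp using terms Z by linarith
  qed
  from mult_left_mono[OF this less_imp_le[OF S]]
  show "\<tau> powr M / 4 * V + \<nu> / 2 * \<tau> powr (M + 1) * Y \<le> G"
    unfolding powrs S_def[symmetric] G by (simp add: algebra_simps add_divide_distrib)
  have "(\<mu> * T + \<nu> * \<tau>) * ((P + Y) / 2) + (Z + V / 2) \<le> (\<mu> * T + \<nu> * \<tau> + T) * (P + Y) + V"
  proof -
    have "0 \<le> (\<mu> * T + \<nu> * \<tau>) * ((P + Y) / 2)"
      using \<mu> \<nu> \<tau> T nonneg by simp
    moreover have "(\<mu> * T + \<nu> * \<tau> + T) * (P + Y) = 2 * ((\<mu> * T + \<nu> * \<tau>) * ((P + Y) / 2)) + T * P + T * Y"
      by (simp add: field_simps)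
    ultimately show ?thesis using terms Z nonneg by linarith
  qed
  from mult_left_mono[OF this less_imp_le[OF S]]
  show "G \<le> (\<mu> * \<tau> powr (M + \<alpha>) + \<nu> * \<tau> powr (M + 1) + \<tau> powr (M + \<alpha>)) * (P + Y) + \<tau> powr M * V"
    unfolding powrs S_def[symmetric] G by (simp add: algebra_simps add_divide_distrib)
qed

text \<open>
  The parameters are fixed in the order \<open>\<kappa>\<close>, \<open>\<mu>\<close>, \<open>\<nu>\<close>, \<open>t\<^sub>0\<close>; the last one is so large that \<open>\<tau>\<^bsup>\<alpha> - 1\<^esup>\<close>
  stays below the required threshold \<open>r\<close>, which is possible because \<open>\<alpha> < 1\<close>. The result is stated in
  terms of \<open>1 + t\<close>, so that functionals with different \<open>t\<^sub>0\<close> can be combined.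
\<close>

lemma lyapunov_functional:
  fixes L M K :: real
  assumes L: "L > 0" and M: "M > 0" and K: "K \<ge> 0"
    and rate: "M / 2 < K + (real CARD('n) - \<alpha>) / ((2 - \<alpha>) * (2 + \<delta>))"
  shows "\<exists>c>0. \<exists>C>0. \<forall>v :: real \<Rightarrow> real^'n \<Rightarrow> real. supported_wave \<alpha> L v \<longrightarrow> (\<exists>G.
    (\<forall>T. continuous_on {0..T} G) \<and>
    (\<forall>t>0. \<exists>D. (G has_real_derivative D) (at t) \<and>
      D \<le> - (c * (1 + t) powr (M + 1) * W t (\<lambda>x. damping \<alpha> x * (time_deriv v t x)\<^sup>2))
        + C * K * (1 + t) powr (M - 1) * W t (\<lambda>x. damping \<alpha> x * (v t x)\<^sup>2)) \<and>
    (\<forall>t\<ge>0. c * (1 + t) powr M * W t (\<lambda>x. damping \<alpha> x * (v t x)\<^sup>2)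
      + c * (1 + t) powr (M + 1) * W t (\<lambda>x. (norm (grad (v t) x))\<^sup>2) \<le> G t) \<and>
    G 0 \<le> C * (W 0 (\<lambda>x. (time_deriv v 0 x)\<^sup>2) + W 0 (\<lambda>x. (norm (grad (v 0) x))\<^sup>2)
      + W 0 (\<lambda>x. damping \<alpha> x * (v 0 x)\<^sup>2)))"
proof -
  define \<kappa> where "\<kappa> = K + (real CARD('n) - \<alpha>) / ((2 - \<alpha>) * (2 + \<delta>)) - M / 2"
  define \<mu> where "\<mu> = max 16 (2 * (2 + \<delta>) / \<delta>)"
  define d where "d = \<delta> / (8 + \<delta>)"
  define \<nu> where "\<nu> = d / (M + 1)"
  define r where "r = min (d / (\<mu> * (M + \<alpha>))) (4 * \<kappa> / M\<^sup>2)"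
  define t0 where "t0 = max (1 + L) (r powr (1 / (\<alpha> - 1)))"
  have \<kappa>: "\<kappa> > 0" using rate by (simp add: \<kappa>_def)
  have \<mu>: "\<mu> \<ge> 16" "\<mu> \<ge> 2 * (2 + \<delta>) / \<delta>" by (auto simp: \<mu>_def)
  have d: "d > 0" "d \<le> 1" using \<delta> by (auto simp: d_def)
  have \<nu>: "\<nu> > 0" "\<nu> \<le> 1" "\<nu> * (M + 1) = d" using d M by (auto simp: \<nu>_def divide_le_eq)
  have r: "r > 0" using d \<mu> M \<alpha> \<kappa> by (simp add: r_def)
  have t0: "t0 \<ge> 1 + L" "t0 > 0" using L by (auto simp: t0_def)
  have "t0 powr (\<alpha> - 1) \<le> (r powr (1 / (\<alpha> - 1))) powr (\<alpha> - 1)"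
    using \<alpha> r by (intro powr_mono2') (auto simp: t0_def)
  also have "\<dots> = r" using \<alpha> r by (simp add: powr_powr)
  finally have t0r: "t0 powr (\<alpha> - 1) \<le> r" .
  have "\<mu> * (M + \<alpha>) * t0 powr (\<alpha> - 1) \<le> \<mu> * (M + \<alpha>) * (d / (\<mu> * (M + \<alpha>)))"
    using t0r \<mu> M \<alpha> by (intro mult_left_mono) (auto simp: r_def)
  also have "\<dots> = d" using \<mu> M \<alpha> by simp
  finally have small1: "\<mu> * (M + \<alpha>) * t0 powr (\<alpha> - 1) \<le> \<delta> / (8 + \<delta>)" by (simp add: d_def)
  have "M\<^sup>2 / (4 * \<kappa>) * t0 powr (\<alpha> - 1) \<le> M\<^sup>2 / (4 * \<kappa>) * (4 * \<kappa> / M\<^sup>2)"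
    using t0r \<kappa> by (intro mult_left_mono) (auto simp: r_def)
  also have "\<dots> = 1" using M \<kappa> by simp
  finally have small2: "M\<^sup>2 / (4 * \<kappa>) * t0 powr (\<alpha> - 1) \<le> 1" .
  define c where "c = \<nu> / 4"
  define C1 where "C1 = \<mu> * t0 powr (M + \<alpha>) + \<nu> * t0 powr (M + 1) + t0 powr (M + \<alpha>)"
  define C where "C = C1 + t0 powr M"
  have c: "c > 0" "c \<le> 1 / 4" using \<nu> by (auto simp: c_def)
  have C1: "C1 > 0" using \<mu> \<nu> t0 by (auto simp: C1_def intro!: add_pos_pos)
  have C: "C > 0" "t0 powr M \<le> C" "C1 \<le> C" using C1 t0 by (auto simp: C_def intro!: add_pos_pos)
  show ?thesis
  proof (rule exI[of _ c], rule conjI, rule c(1), rule exI[of _ C], rule conjI, rule C(1), intro allI impI)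
    fix v :: "real \<Rightarrow> real^'n \<Rightarrow> real"
    assume sol: "supported_wave \<alpha> L v"
    define G where "G = (\<lambda>t. (\<mu> * (t0 + t) powr (M + \<alpha>) + \<nu> * (t0 + t) powr (M + 1))
        * wave_energy (\<lambda>t x. exp (2 * weight \<alpha> \<delta> t x)) v t
      + (t0 + t) powr M * wave_mass (damping \<alpha>) (\<lambda>t x. exp (2 * weight \<alpha> \<delta> t x)) v t)"
    note deriv = lyapunov_functional_derivative[OF \<alpha> \<delta> sol L M K \<kappa>_def \<kappa> \<mu> \<nu>(1) _ t0(1) small1 small2,
        folded G_def, unfolded \<nu>(3), unfolded d_def, OF order_refl]
    have nonneg: "W t (\<lambda>x. damping \<alpha> x * (v t x)\<^sup>2) \<ge> 0" "W t (\<lambda>x. (norm (grad (v t) x))\<^sup>2) \<ge> 0"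
      "W t (\<lambda>x. damping \<alpha> x * (time_deriv v t x)\<^sup>2) \<ge> 0" "W t (\<lambda>x. (time_deriv v t x)\<^sup>2) \<ge> 0" for t
      by (intro weighted_integral_nonneg[OF \<alpha> \<delta>]; simp add: less_imp_le[OF damping_pos])+
    have \<mu>2: "\<mu> \<ge> 2" using \<mu> by simp
    note bounds = lyapunov_functional_bounds[OF sol L \<mu>2 less_imp_le[OF \<nu>(1)] _ t0(1), where M = M]
    show "\<exists>G. (\<forall>T. continuous_on {0..T} G) \<and>
      (\<forall>t>0. \<exists>D. (G has_real_derivative D) (at t) \<and>
        D \<le> - (c * (1 + t) powr (M + 1) * W t (\<lambda>x. damping \<alpha> x * (time_deriv v t x)\<^sup>2))
          + C * K * (1 + t) powr (M - 1) * W t (\<lambda>x. damping \<alpha> x * (v t x)\<^sup>2)) \<and>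
      (\<forall>t\<ge>0. c * (1 + t) powr M * W t (\<lambda>x. damping \<alpha> x * (v t x)\<^sup>2)
        + c * (1 + t) powr (M + 1) * W t (\<lambda>x. (norm (grad (v t) x))\<^sup>2) \<le> G t) \<and>
      G 0 \<le> C * (W 0 (\<lambda>x. (time_deriv v 0 x)\<^sup>2) + W 0 (\<lambda>x. (norm (grad (v 0) x))\<^sup>2)
        + W 0 (\<lambda>x. damping \<alpha> x * (v 0 x)\<^sup>2))"
    proof (intro exI[of _ G] conjI allI impI)
      show "continuous_on {0..T} G" for T by (rule deriv(1))
    next
      fix t :: real assume t: "t > 0"
      from deriv(2)[OF t] obtain D where D: "(G has_real_derivative D) (at t)"
        and le: "D \<le> - (\<nu> / 4 * (t0 + t) powr (M + 1) * W t (\<lambda>x. damping \<alpha> x * (time_deriv v t x)\<^sup>2))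
          + K * (t0 + t) powr (M - 1) * W t (\<lambda>x. damping \<alpha> x * (v t x)\<^sup>2)" by blast
      have "c * (1 + t) powr (M + 1) * W t (\<lambda>x. damping \<alpha> x * (time_deriv v t x)\<^sup>2)
          \<le> \<nu> / 4 * (t0 + t) powr (M + 1) * W t (\<lambda>x. damping \<alpha> x * (time_deriv v t x)\<^sup>2)"
        unfolding c_def using t t0 L M \<nu> nonneg
        by (intro mult_right_mono mult_left_mono powr_mono2) auto
      moreover have "K * (t0 + t) powr (M - 1) * W t (\<lambda>x. damping \<alpha> x * (v t x)\<^sup>2)
          \<le> C * K * (1 + t) powr (M - 1) * W t (\<lambda>x. damping \<alpha> x * (v t x)\<^sup>2)"
      proof -
        have "t0 + t \<le> t0 * (1 + t)" using t t0 L by (simp add: algebra_simps)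
        then have "(t0 + t) powr M \<le> (t0 * (1 + t)) powr M"
          using t t0 M by (intro powr_mono2) auto
        then have "(t0 + t) powr M / (t0 + t) \<le> (t0 powr M * (1 + t) powr M) / (1 + t)"
          using t t0 L by (intro frac_le) (auto simp: powr_mult)
        then have "(t0 + t) powr (M - 1) \<le> t0 powr M * (1 + t) powr (M - 1)"
          using t t0 by (simp add: powr_diff)
        also have "\<dots> \<le> C * (1 + t) powr (M - 1)"
          using C by (intro mult_right_mono) auto
        finally have "K * (t0 + t) powr (M - 1) \<le> K * (C * (1 + t) powr (M - 1))"
          using K by (intro mult_left_mono)
        from mult_right_mono[OF this nonneg(1)[of t]] show ?thesis by (simp add: mult_ac)
      qed
      ultimately have "D \<le> - (c * (1 + t) powr (M + 1) * W t (\<lambda>x. damping \<alpha> x * (time_deriv v t x)\<^sup>2))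
          + C * K * (1 + t) powr (M - 1) * W t (\<lambda>x. damping \<alpha> x * (v t x)\<^sup>2)"
        using le by linarith
      with D show "\<exists>D. (G has_real_derivative D) (at t) \<and>
          D \<le> - (c * (1 + t) powr (M + 1) * W t (\<lambda>x. damping \<alpha> x * (time_deriv v t x)\<^sup>2))
            + C * K * (1 + t) powr (M - 1) * W t (\<lambda>x. damping \<alpha> x * (v t x)\<^sup>2)" by blast
    next
      fix t :: real assume t: "t \<ge> 0"
      have "c * (1 + t) powr M * W t (\<lambda>x. damping \<alpha> x * (v t x)\<^sup>2)
          \<le> 1 / 4 * (t0 + t) powr M * W t (\<lambda>x. damping \<alpha> x * (v t x)\<^sup>2)"
        using t t0 L M c nonneg by (intro mult_right_mono mult_mono powr_mono2) auto
      moreover have "c * (1 + t) powr (M + 1) * W t (\<lambda>x. (norm (grad (v t) x))\<^sup>2)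
          \<le> \<nu> / 2 * (t0 + t) powr (M + 1) * W t (\<lambda>x. (norm (grad (v t) x))\<^sup>2)"
        using t t0 L M \<nu> nonneg by (intro mult_right_mono mult_mono powr_mono2) (auto simp: c_def)
      ultimately show "c * (1 + t) powr M * W t (\<lambda>x. damping \<alpha> x * (v t x)\<^sup>2)
        + c * (1 + t) powr (M + 1) * W t (\<lambda>x. (norm (grad (v t) x))\<^sup>2) \<le> G t"
        using bounds(1)[OF t] unfolding G_def by simp
    next
      let ?E0 = "W 0 (\<lambda>x. (time_deriv v 0 x)\<^sup>2) + W 0 (\<lambda>x. (norm (grad (v 0) x))\<^sup>2)"
        and ?V0 = "W 0 (\<lambda>x. damping \<alpha> x * (v 0 x)\<^sup>2)"
      have "G 0 \<le> C1 * ?E0 + t0 powr M * ?V0"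
        using bounds(2)[OF order_refl] unfolding G_def C1_def by simp
      also have "\<dots> \<le> C * ?E0 + C * ?V0"
        using C nonneg[of 0] by (intro add_mono mult_right_mono) auto
      finally show "G 0 \<le> C * (?E0 + ?V0)" by (simp add: distrib_left)
    qed
  qed
qed

end

section \<open>Decay of the derivatives in time\<close>

lemma supported_wave_funpow: "supported_wave \<alpha> L u \<Longrightarrow> supported_wave \<alpha> L ((time_deriv ^^ k) u)"
  by (induction k) (auto intro: supported_wave_time_deriv)

context
  fixes \<alpha> \<delta> :: real
  assumes \<alpha>: "0 \<le> \<alpha>" "\<alpha> < 1" and \<delta>: "0 < \<delta>"
begin

abbreviation (input) "I u k \<equiv> initial_energy \<alpha> \<delta> (u 0) (time_deriv u 0) u k"

lemma initial_energy_0: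
  fixes u :: "real \<Rightarrow> real^'n \<Rightarrow> real"
  assumes "supported_wave \<alpha> L u"
  shows "I u 0 = W \<alpha> \<delta> 0 (\<lambda>x. (u 0 x)\<^sup>2) + W \<alpha> \<delta> 0 (\<lambda>x. (norm (grad (u 0) x))\<^sup>2)
    + W \<alpha> \<delta> 0 (\<lambda>x. (time_deriv u 0 x)\<^sup>2)"
  using integrable_weighted_wave(2,3)[OF \<alpha> \<delta> assms order_refl]
    integrable_weighted_wave(2)[OF \<alpha> \<delta> supported_wave_time_deriv[OF assms] order_refl]
  by (simp add: weighted_integral_def distrib_left)

lemma initial_energy_Suc:
  fixes u :: "real \<Rightarrow> real^'n \<Rightarrow> real"
  assumes "supported_wave \<alpha> L u"
  shows "I u (Suc k) = W \<alpha> \<delta> 0 (\<lambda>x. ((time_deriv ^^ (Suc (Suc k))) u 0 x)\<^sup>2)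
    + W \<alpha> \<delta> 0 (\<lambda>x. (norm (grad ((time_deriv ^^ Suc k) u 0) x))\<^sup>2) + I u k"
  using integrable_weighted_wave(3)[OF \<alpha> \<delta> supported_wave_funpow[OF assms, of "Suc k"] order_refl]
    integrable_weighted_wave(2)[OF \<alpha> \<delta> supported_wave_funpow[OF assms, of "Suc (Suc k)"] order_refl]
  by (simp add: weighted_integral_def distrib_left)

lemma initial_energy_nonneg:
  fixes u :: "real \<Rightarrow> real^'n \<Rightarrow> real"
  assumes "supported_wave \<alpha> L u"
  shows "I u k \<ge> 0"
proof (induction k)
  case 0
  show ?case
    unfolding initial_energy_0[OF assms] by (intro add_nonneg_nonneg weighted_integral_nonneg[OF \<alpha> \<delta>]) auto
next
  case (Suc k)
  then show ?case
    unfolding initial_energy_Suc[OF assms] by (intro add_nonneg_nonneg weighted_integral_nonneg[OF \<alpha> \<delta>]) auto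
qed

text \<open>
  Bounds the term \<open>\<integral> \<phi> a v\<^sup>2\<close> at \<open>t = 0\<close> for \<open>v = \<partial>\<^sub>t\<^bsup>k + 1\<^esup> u\<close>: the square of \<open>v\<close> already occurs in
  the energy of order \<open>k\<close>.
\<close>

lemma initial_time_derivative_le:
  fixes u :: "real \<Rightarrow> real^'n \<Rightarrow> real"
  assumes "supported_wave \<alpha> L u"
  shows "W \<alpha> \<delta> 0 (\<lambda>x. ((time_deriv ^^ Suc k) u 0 x)\<^sup>2) \<le> I u k"
proof (cases k)
  case 0
  have "W \<alpha> \<delta> 0 (\<lambda>x. (u 0 x)\<^sup>2) \<ge> 0" "W \<alpha> \<delta> 0 (\<lambda>x. (norm (grad (u 0) x))\<^sup>2) \<ge> 0"
    by (intro weighted_integral_nonneg[OF \<alpha> \<delta>]; simp)+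
  then show ?thesis unfolding 0 initial_energy_0[OF assms] by simp
next
  case (Suc j)
  have "W \<alpha> \<delta> 0 (\<lambda>x. (norm (grad ((time_deriv ^^ Suc j) u 0) x))\<^sup>2) \<ge> 0"
    by (intro weighted_integral_nonneg[OF \<alpha> \<delta>]) simp
  then show ?thesis
    unfolding Suc initial_energy_Suc[OF assms] using initial_energy_nonneg[OF assms, of j] by simp
qed

lemma weighted_integral_damping_le:
  fixes v :: "real \<Rightarrow> real^'n \<Rightarrow> real"
  assumes "supported_wave \<alpha> L v" "t \<ge> 0"
  shows "W \<alpha> \<delta> t (\<lambda>x. damping \<alpha> x * (v t x)\<^sup>2) \<le> W \<alpha> \<delta> t (\<lambda>x. (v t x)\<^sup>2)"
  unfolding weighted_integral_def using integrable_weighted_wave(1,2)[OF \<alpha> \<delta> assms]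
  by (intro integral_mono mult_left_mono mult_left_le_one_le damping_le_1 \<alpha> less_imp_le[OF damping_pos]) auto

text \<open>
  Passing from \<open>k\<close> to \<open>k + 1\<close> raises the exponent \<open>M\<close> by \<open>2\<close>, and the functional of \<open>\<partial>\<^sub>t\<^bsup>k + 1\<^esup> u\<close> alone
  may grow, with a rate controlled by \<open>(1 + t)\<^bsup>M - 1\<^esup> \<integral> \<phi> a |\<partial>\<^sub>t\<^bsup>k + 1\<^esup> u|\<^sup>2\<close>. This is the dissipation of
  the functional of order \<open>k\<close>, with the same power of \<open>1 + t\<close>. The new functional is the sum of the two,
  with a factor \<open>b\<close> at the old one that makes these terms cancel.
\<close>

lemma iterated_lyapunov_functional:
  fixes L m :: real
  assumes L: "L > 0" and m: "m > 0"
    and rate: "m / 2 < (real CARD('n) - \<alpha>) / ((2 - \<alpha>) * (2 + \<delta>))"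
  shows "\<exists>c>0. \<exists>C>0. \<forall>u :: real \<Rightarrow> real^'n \<Rightarrow> real. supported_wave \<alpha> L u \<longrightarrow> (\<exists>F.
    (\<forall>T. continuous_on {0..T} F) \<and>
    (\<forall>t>0. \<exists>D. (F has_real_derivative D) (at t) \<and>
      D \<le> - (c * (1 + t) powr (m + 2 * real k + 1)
        * W \<alpha> \<delta> t (\<lambda>x. damping \<alpha> x * ((time_deriv ^^ Suc k) u t x)\<^sup>2))) \<and>
    (\<forall>t\<ge>0. c * (1 + t) powr (m + 2 * real k) * W \<alpha> \<delta> t (\<lambda>x. damping \<alpha> x * ((time_deriv ^^ k) u t x)\<^sup>2)
      + c * (1 + t) powr (m + 2 * real k + 1) * W \<alpha> \<delta> t (\<lambda>x. (norm (grad ((time_deriv ^^ k) u t) x))\<^sup>2)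
      \<le> F t) \<and>
    F 0 \<le> C * I u k)"
proof (induction k)
  case 0
  from lyapunov_functional[where 'n = 'n, OF \<alpha> \<delta> L m order_refl] rate
  obtain c C where c: "c > 0" and C: "C > 0" and step: "\<And>v :: real \<Rightarrow> real^'n \<Rightarrow> real. supported_wave \<alpha> L v \<Longrightarrow> (\<exists>G.
    (\<forall>T. continuous_on {0..T} G) \<and>
    (\<forall>t>0. \<exists>D. (G has_real_derivative D) (at t) \<and>
      D \<le> - (c * (1 + t) powr (m + 1) * W \<alpha> \<delta> t (\<lambda>x. damping \<alpha> x * (time_deriv v t x)\<^sup>2))) \<and>
    (\<forall>t\<ge>0. c * (1 + t) powr m * W \<alpha> \<delta> t (\<lambda>x. damping \<alpha> x * (v t x)\<^sup>2)
      + c * (1 + t) powr (m + 1) * W \<alpha> \<delta> t (\<lambda>x. (norm (grad (v t) x))\<^sup>2) \<le> G t) \<and>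
    G 0 \<le> C * (W \<alpha> \<delta> 0 (\<lambda>x. (time_deriv v 0 x)\<^sup>2) + W \<alpha> \<delta> 0 (\<lambda>x. (norm (grad (v 0) x))\<^sup>2)
      + W \<alpha> \<delta> 0 (\<lambda>x. damping \<alpha> x * (v 0 x)\<^sup>2)))"
    by (simp only: mult_zero_left mult_zero_right add_0_left add_0_right) blast
  have init: "C * (W \<alpha> \<delta> 0 (\<lambda>x. (time_deriv u 0 x)\<^sup>2) + W \<alpha> \<delta> 0 (\<lambda>x. (norm (grad (u 0) x))\<^sup>2)
      + W \<alpha> \<delta> 0 (\<lambda>x. damping \<alpha> x * (u 0 x)\<^sup>2)) \<le> C * I u 0"
    if "supported_wave \<alpha> L u" for u :: "real \<Rightarrow> real^'n \<Rightarrow> real"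
    unfolding initial_energy_0[OF that]
    using weighted_integral_damping_le[OF that order_refl] C by (intro mult_left_mono) auto
  show ?case
  proof (rule exI[of _ c], rule conjI, rule c, rule exI[of _ C], rule conjI, rule C, intro allI impI)
    fix u :: "real \<Rightarrow> real^'n \<Rightarrow> real"
    assume sol: "supported_wave \<alpha> L u"
    from step[OF sol] init[OF sol] show "\<exists>F.
      (\<forall>T. continuous_on {0..T} F) \<and>
      (\<forall>t>0. \<exists>D. (F has_real_derivative D) (at t) \<and>
        D \<le> - (c * (1 + t) powr (m + 2 * real 0 + 1)
          * W \<alpha> \<delta> t (\<lambda>x. damping \<alpha> x * ((time_deriv ^^ Suc 0) u t x)\<^sup>2))) \<and>
      (\<forall>t\<ge>0. c * (1 + t) powr (m + 2 * real 0) * W \<alpha> \<delta> t (\<lambda>x. damping \<alpha> x * ((time_deriv ^^ 0) u t x)\<^sup>2)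
        + c * (1 + t) powr (m + 2 * real 0 + 1) * W \<alpha> \<delta> t (\<lambda>x. (norm (grad ((time_deriv ^^ 0) u t) x))\<^sup>2)
        \<le> F t) \<and>
      F 0 \<le> C * I u 0"
      unfolding of_nat_0 mult_zero_right add_0_right funpow.simps o_apply id_apply
      by (meson order_trans)
  qed
next
  case (Suc k)
  define M where "M = m + 2 * real (Suc k)"
  have M: "M > 0" using m by (simp add: M_def)
  have Mk: "M - 1 = m + 2 * real k + 1" by (simp add: M_def)
  from Suc.IH obtain c1 C1 where c1: "c1 > 0" and C1: "C1 > 0"
    and IH: "\<And>u :: real \<Rightarrow> real^'n \<Rightarrow> real. supported_wave \<alpha> L u \<Longrightarrow> (\<exists>F.
    (\<forall>T. continuous_on {0..T} F) \<and>
    (\<forall>t>0. \<exists>D. (F has_real_derivative D) (at t) \<and>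
      D \<le> - (c1 * (1 + t) powr (M - 1)
        * W \<alpha> \<delta> t (\<lambda>x. damping \<alpha> x * ((time_deriv ^^ Suc k) u t x)\<^sup>2))) \<and>
    (\<forall>t\<ge>0. c1 * (1 + t) powr (m + 2 * real k) * W \<alpha> \<delta> t (\<lambda>x. damping \<alpha> x * ((time_deriv ^^ k) u t x)\<^sup>2)
      + c1 * (1 + t) powr (M - 1) * W \<alpha> \<delta> t (\<lambda>x. (norm (grad ((time_deriv ^^ k) u t) x))\<^sup>2)
      \<le> F t) \<and>
    F 0 \<le> C1 * I u k)"
    unfolding Mk by blast
  have "M / 2 < M + (real CARD('n) - \<alpha>) / ((2 - \<alpha>) * (2 + \<delta>))" using rate m M by linarith
  from lyapunov_functional[where 'n = 'n, OF \<alpha> \<delta> L M less_imp_le[OF M] this]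
  obtain c2 C2 where c2: "c2 > 0" and C2: "C2 > 0"
    and step: "\<And>v :: real \<Rightarrow> real^'n \<Rightarrow> real. supported_wave \<alpha> L v \<Longrightarrow> (\<exists>G.
    (\<forall>T. continuous_on {0..T} G) \<and>
    (\<forall>t>0. \<exists>D. (G has_real_derivative D) (at t) \<and>
      D \<le> - (c2 * (1 + t) powr (M + 1) * W \<alpha> \<delta> t (\<lambda>x. damping \<alpha> x * (time_deriv v t x)\<^sup>2))
        + C2 * M * (1 + t) powr (M - 1) * W \<alpha> \<delta> t (\<lambda>x. damping \<alpha> x * (v t x)\<^sup>2)) \<and>
    (\<forall>t\<ge>0. c2 * (1 + t) powr M * W \<alpha> \<delta> t (\<lambda>x. damping \<alpha> x * (v t x)\<^sup>2)
      + c2 * (1 + t) powr (M + 1) * W \<alpha> \<delta> t (\<lambda>x. (norm (grad (v t) x))\<^sup>2) \<le> G t) \<and>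
    G 0 \<le> C2 * (W \<alpha> \<delta> 0 (\<lambda>x. (time_deriv v 0 x)\<^sup>2) + W \<alpha> \<delta> 0 (\<lambda>x. (norm (grad (v 0) x))\<^sup>2)
      + W \<alpha> \<delta> 0 (\<lambda>x. damping \<alpha> x * (v 0 x)\<^sup>2)))"
    by blast
  define b where "b = C2 * M / c1"
  have b: "b > 0" "b * c1 = C2 * M" using C2 M c1 by (auto simp: b_def)
  define C where "C = b * C1 + C2"
  have C: "C > 0" "C2 \<le> C" using b C1 C2 by (auto simp: C_def intro!: add_pos_pos)
  show ?case
    unfolding M_def[symmetric]
  proof (rule exI[of _ c2], rule conjI, rule c2, rule exI[of _ C], rule conjI, rule C(1), intro allI impI)
    fix u :: "real \<Rightarrow> real^'n \<Rightarrow> real"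
    assume sol: "supported_wave \<alpha> L u"
    let ?v = "(time_deriv ^^ Suc k) u"
    have sol_v: "supported_wave \<alpha> L ?v" by (rule supported_wave_funpow[OF sol])
    from IH[OF sol] obtain F where contF: "\<And>T. continuous_on {0..T} F"
      and derivF: "\<And>t. t > 0 \<Longrightarrow> \<exists>D. (F has_real_derivative D) (at t) \<and>
        D \<le> - (c1 * (1 + t) powr (M - 1) * W \<alpha> \<delta> t (\<lambda>x. damping \<alpha> x * (?v t x)\<^sup>2))"
      and lowerF: "\<And>t. t \<ge> 0 \<Longrightarrow>
        c1 * (1 + t) powr (m + 2 * real k) * W \<alpha> \<delta> t (\<lambda>x. damping \<alpha> x * ((time_deriv ^^ k) u t x)\<^sup>2)
        + c1 * (1 + t) powr (M - 1) * W \<alpha> \<delta> t (\<lambda>x. (norm (grad ((time_deriv ^^ k) u t) x))\<^sup>2) \<le> F t"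
      and F0: "F 0 \<le> C1 * I u k"
      by blast
    have F_nonneg: "F t \<ge> 0" if "t \<ge> 0" for t
      using c1 by (intro order_trans[OF _ lowerF[OF that]] add_nonneg_nonneg mult_nonneg_nonneg
          weighted_integral_nonneg[OF \<alpha> \<delta>]) (auto simp: less_imp_le[OF damping_pos])
    from step[OF sol_v] obtain G where contG: "\<And>T. continuous_on {0..T} G"
      and derivG: "\<And>t. t > 0 \<Longrightarrow> \<exists>D. (G has_real_derivative D) (at t) \<and>
        D \<le> - (c2 * (1 + t) powr (M + 1) * W \<alpha> \<delta> t (\<lambda>x. damping \<alpha> x * (time_deriv ?v t x)\<^sup>2))
          + C2 * M * (1 + t) powr (M - 1) * W \<alpha> \<delta> t (\<lambda>x. damping \<alpha> x * (?v t x)\<^sup>2)"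
      and lowerG: "\<And>t. t \<ge> 0 \<Longrightarrow> c2 * (1 + t) powr M * W \<alpha> \<delta> t (\<lambda>x. damping \<alpha> x * (?v t x)\<^sup>2)
        + c2 * (1 + t) powr (M + 1) * W \<alpha> \<delta> t (\<lambda>x. (norm (grad (?v t) x))\<^sup>2) \<le> G t"
      and G0: "G 0 \<le> C2 * (W \<alpha> \<delta> 0 (\<lambda>x. (time_deriv ?v 0 x)\<^sup>2) + W \<alpha> \<delta> 0 (\<lambda>x. (norm (grad (?v 0) x))\<^sup>2)
        + W \<alpha> \<delta> 0 (\<lambda>x. damping \<alpha> x * (?v 0 x)\<^sup>2))"
      by blast
    have v': "time_deriv ?v = (time_deriv ^^ Suc (Suc k)) u" by simp
    show "\<exists>F. (\<forall>T. continuous_on {0..T} F) \<and>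
      (\<forall>t>0. \<exists>D. (F has_real_derivative D) (at t) \<and>
        D \<le> - (c2 * (1 + t) powr (M + 1)
          * W \<alpha> \<delta> t (\<lambda>x. damping \<alpha> x * ((time_deriv ^^ Suc (Suc k)) u t x)\<^sup>2))) \<and>
      (\<forall>t\<ge>0. c2 * (1 + t) powr M * W \<alpha> \<delta> t (\<lambda>x. damping \<alpha> x * (?v t x)\<^sup>2)
        + c2 * (1 + t) powr (M + 1) * W \<alpha> \<delta> t (\<lambda>x. (norm (grad (?v t) x))\<^sup>2) \<le> F t) \<and>
      F 0 \<le> C * I u (Suc k)"
    proof (intro exI[of _ "\<lambda>t. b * F t + G t"] conjI allI impI)
      show "continuous_on {0..T} (\<lambda>t. b * F t + G t)" for T
        by (intro continuous_intros contF contG)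
    next
      fix t :: real assume t: "t > 0"
      from derivF[OF t] obtain D1 where D1: "(F has_real_derivative D1) (at t)"
        "D1 \<le> - (c1 * (1 + t) powr (M - 1) * W \<alpha> \<delta> t (\<lambda>x. damping \<alpha> x * (?v t x)\<^sup>2))" by blast
      from derivG[OF t] obtain D2 where D2: "(G has_real_derivative D2) (at t)"
        "D2 \<le> - (c2 * (1 + t) powr (M + 1) * W \<alpha> \<delta> t (\<lambda>x. damping \<alpha> x * (time_deriv ?v t x)\<^sup>2))
          + C2 * M * (1 + t) powr (M - 1) * W \<alpha> \<delta> t (\<lambda>x. damping \<alpha> x * (?v t x)\<^sup>2)" by blast
      have "b * D1 \<le> - (b * c1 * (1 + t) powr (M - 1) * W \<alpha> \<delta> t (\<lambda>x. damping \<alpha> x * (?v t x)\<^sup>2))"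
        using mult_left_mono[OF D1(2) less_imp_le[OF b(1)]] by (simp add: mult.assoc)
      then have "b * D1 + D2
          \<le> - (c2 * (1 + t) powr (M + 1) * W \<alpha> \<delta> t (\<lambda>x. damping \<alpha> x * (time_deriv ?v t x)\<^sup>2))"
        using D2(2) unfolding b(2) by linarith
      moreover have "((\<lambda>t. b * F t + G t) has_real_derivative b * D1 + D2) (at t)"
        by (intro DERIV_add DERIV_cmult D1(1) D2(1))
      ultimately show "\<exists>D. ((\<lambda>t. b * F t + G t) has_real_derivative D) (at t) \<and>
          D \<le> - (c2 * (1 + t) powr (M + 1)
            * W \<alpha> \<delta> t (\<lambda>x. damping \<alpha> x * ((time_deriv ^^ Suc (Suc k)) u t x)\<^sup>2))"
        unfolding v'[symmetric] by blast
    next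
      fix t :: real assume t: "t \<ge> 0"
      show "c2 * (1 + t) powr M * W \<alpha> \<delta> t (\<lambda>x. damping \<alpha> x * (?v t x)\<^sup>2)
        + c2 * (1 + t) powr (M + 1) * W \<alpha> \<delta> t (\<lambda>x. (norm (grad (?v t) x))\<^sup>2) \<le> b * F t + G t"
        using lowerG[OF t] mult_nonneg_nonneg[OF less_imp_le[OF b(1)] F_nonneg[OF t]] by linarith
    next
      have "W \<alpha> \<delta> 0 (\<lambda>x. damping \<alpha> x * (?v 0 x)\<^sup>2) \<le> I u k"
        by (rule order_trans[OF weighted_integral_damping_le[OF sol_v order_refl] initial_time_derivative_le[OF sol]])
      then have "W \<alpha> \<delta> 0 (\<lambda>x. (time_deriv ?v 0 x)\<^sup>2) + W \<alpha> \<delta> 0 (\<lambda>x. (norm (grad (?v 0) x))\<^sup>2)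
          + W \<alpha> \<delta> 0 (\<lambda>x. damping \<alpha> x * (?v 0 x)\<^sup>2) \<le> I u (Suc k)"
        unfolding initial_energy_Suc[OF sol] v' by linarith
      from mult_left_mono[OF this less_imp_le[OF C2]] have "G 0 \<le> C2 * I u (Suc k)"
        using G0 by linarith
      moreover have "b * F 0 \<le> b * C1 * I u (Suc k)"
      proof -
        have "I u k \<le> I u (Suc k)"
          unfolding initial_energy_Suc[OF sol]
          using weighted_integral_nonneg[OF \<alpha> \<delta>, of "\<lambda>x. ((time_deriv ^^ (Suc (Suc k))) u 0 x)\<^sup>2" 0]
            weighted_integral_nonneg[OF \<alpha> \<delta>, of "\<lambda>x. (norm (grad ((time_deriv ^^ Suc k) u 0) x))\<^sup>2" 0]
          by simp
        from mult_left_mono[OF this less_imp_le[OF C1]] F0 have "F 0 \<le> C1 * I u (Suc k)" by linarith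
        from mult_left_mono[OF this less_imp_le[OF b(1)]] show ?thesis by (simp only: mult.assoc)
      qed
      ultimately show "b * F 0 + G 0 \<le> C * I u (Suc k)"
        unfolding C_def distrib_right by linarith
    qed
  qed
qed

end

lemma supported_wave_of_solution:
  fixes u0 u1 :: "real^'n \<Rightarrow> real"
  assumes "damped_wave_solution \<alpha> u0 u1 u" "supp u0 \<union> supp u1 \<subseteq> cball 0 L"
  shows "supported_wave \<alpha> L u"
  unfolding supported_wave_def
proof (intro conjI allI impI)
  show wave: "damped_wave (damping \<alpha>) u"
    using assms(1) by (simp add: damped_wave_solution_def damped_wave_def future_smooth_def numeral_2_eq_2)
  have outside: "f x = 0" if "supp f \<subseteq> cball 0 L" "norm x > L" for f :: "real^'n \<Rightarrow> real" and x
  proof (rule ccontr)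
    assume "f x \<noteq> 0"
    then have "x \<in> supp f"
      unfolding supp_def by (intro subsetD[OF closure_subset]) (simp add: support_on_def)
    with that show False by auto
  qed
  have initial: "u 0 x = 0" "time_deriv u 0 x = 0" if "norm x > L" for x
    using assms outside[of u0 x] outside[of u1 x] that by (simp_all add: damped_wave_solution_def)
  show "u t x = 0" if "t \<ge> 0" "norm x > L + t" for t x
    by (rule finite_propagation_speed[OF wave continuous_on_damping less_imp_le[OF damping_pos]
          initial(1) initial(2) that])
qed

theorem theorem1p2:
  fixes \<alpha> L :: real
  assumes "0 \<le> \<alpha>" and "\<alpha> < 1" and "L > 0"
  shows "\<exists>\<epsilon>0>0. \<forall>\<epsilon>. 0 < \<epsilon> \<and> \<epsilon> < \<epsilon>0 \<longrightarrow> (\<exists>\<delta>>0. \<forall>k::nat. \<exists>C>0.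
    \<forall>(u0 :: real^'n \<Rightarrow> real) u1 u.
      smooth_on UNIV u0 \<and> smooth_on UNIV u1 \<and> supp u0 \<union> supp u1 \<subseteq> cball 0 L \<and>
      damped_wave_solution \<alpha> u0 u1 u \<longrightarrow>
      (\<forall>t\<ge>0.
        integrable lborel
          (\<lambda>x. exp (2 * weight \<alpha> \<delta> t x) * damping \<alpha> x * \<bar>(time_deriv ^^ k) u t x\<bar>\<^sup>2) \<and>
        (1 + t) powr ((real CARD('n) - \<alpha>) / (2 - \<alpha>) + 2 * real k - \<epsilon>) *
          (LINT x|lborel. exp (2 * weight \<alpha> \<delta> t x) * damping \<alpha> x * \<bar>(time_deriv ^^ k) u t x\<bar>\<^sup>2)
          \<le> C * initial_energy \<alpha> \<delta> u0 u1 u k \<and>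
        integrable lborel
          (\<lambda>x. exp (2 * weight \<alpha> \<delta> t x) * (norm (grad ((time_deriv ^^ k) u t) x))\<^sup>2) \<and>
        (1 + t) powr ((real CARD('n) - \<alpha>) / (2 - \<alpha>) + 2 * real k + 1 - \<epsilon>) *
          (LINT x|lborel. exp (2 * weight \<alpha> \<delta> t x) * (norm (grad ((time_deriv ^^ k) u t) x))\<^sup>2)
          \<le> C * initial_energy \<alpha> \<delta> u0 u1 u k))"
proof -
  define m0 where "m0 = (real CARD('n) - \<alpha>) / (2 - \<alpha>)"
  have "real CARD('n) \<ge> 1" using one_le_card_finite[where 'a = 'n] by linarith
  then have "real CARD('n) - \<alpha> > 0" using assms by linarith
  then have m0: "m0 > 0" unfolding m0_def by (rule divide_pos_pos) (use assms in simp)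
  show ?thesis
    unfolding m0_def[symmetric]
  proof (rule exI[of _ m0], rule conjI, rule m0, intro allI impI, elim conjE)
    fix \<epsilon> :: real
    assume \<epsilon>: "0 < \<epsilon>" "\<epsilon> < m0"
    \<comment> \<open>Any \<open>\<delta> < 2 \<epsilon> / (m0 - \<epsilon>)\<close> would satisfy the condition \<open>m / 2 < B\<close>.\<close>
    define \<delta> where "\<delta> = \<epsilon> / m0"
    have \<delta>: "\<delta> > 0" using \<epsilon> m0 by (simp add: \<delta>_def)
    define m where "m = m0 - \<epsilon>"
    have m: "m > 0" using \<epsilon> by (simp add: m_def)
    have rate: "m / 2 < (real CARD('n) - \<alpha>) / ((2 - \<alpha>) * (2 + \<delta>))"
    proof -
      have "m * (2 + \<delta>) = 2 * m0 - 2 * \<epsilon> + \<epsilon> * (m / m0)"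
        by (simp add: m_def \<delta>_def algebra_simps)
      also have "\<epsilon> * (m / m0) < \<epsilon> * 1"
        using \<epsilon> m0 by (intro mult_strict_left_mono) (auto simp: m_def)
      finally have "m * (2 + \<delta>) < 2 * m0" using \<epsilon> by linarith
      then have "m / 2 < m0 / (2 + \<delta>)" using \<delta> by (simp add: field_simps)
      then show ?thesis by (simp add: m0_def)
    qed
    show "\<exists>\<delta>>0. \<forall>k::nat. \<exists>C>0.
      \<forall>(u0 :: real^'n \<Rightarrow> real) u1 u.
      smooth_on UNIV u0 \<and> smooth_on UNIV u1 \<and> supp u0 \<union> supp u1 \<subseteq> cball 0 L \<and>
      damped_wave_solution \<alpha> u0 u1 u \<longrightarrow>
      (\<forall>t\<ge>0.
        integrable lborel
          (\<lambda>x. exp (2 * weight \<alpha> \<delta> t x) * damping \<alpha> x * \<bar>(time_deriv ^^ k) u t x\<bar>\<^sup>2) \<and>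
        (1 + t) powr (m0 + 2 * real k - \<epsilon>) *
          (LINT x|lborel. exp (2 * weight \<alpha> \<delta> t x) * damping \<alpha> x * \<bar>(time_deriv ^^ k) u t x\<bar>\<^sup>2)
          \<le> C * initial_energy \<alpha> \<delta> u0 u1 u k \<and>
        integrable lborel
          (\<lambda>x. exp (2 * weight \<alpha> \<delta> t x) * (norm (grad ((time_deriv ^^ k) u t) x))\<^sup>2) \<and>
        (1 + t) powr (m0 + 2 * real k + 1 - \<epsilon>) *
          (LINT x|lborel. exp (2 * weight \<alpha> \<delta> t x) * (norm (grad ((time_deriv ^^ k) u t) x))\<^sup>2)
          \<le> C * initial_energy \<alpha> \<delta> u0 u1 u k)"
    proof (rule exI[of _ \<delta>], rule conjI, rule \<delta>, rule allI)
      fix k :: nat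
      have e1: "m0 + 2 * real k - \<epsilon> = m + 2 * real k"
        and e2: "m0 + 2 * real k + 1 - \<epsilon> = m + 2 * real k + 1"
        by (simp_all add: m_def)
      let ?W = "weighted_integral \<alpha> \<delta> :: _ \<Rightarrow> (real^'n \<Rightarrow> real) \<Rightarrow> real"
      from iterated_lyapunov_functional[where 'n = 'n, OF assms(1,2) \<delta> assms(3) m rate, of k]
      obtain c C where c: "c > 0" and C: "C > 0" and lyap: "\<And>u :: real \<Rightarrow> real^'n \<Rightarrow> real. supported_wave \<alpha> L u \<Longrightarrow> \<exists>F.
        (\<forall>T. continuous_on {0..T} F) \<and>
        (\<forall>t>0. \<exists>D. (F has_real_derivative D) (at t) \<and>
          D \<le> - (c * (1 + t) powr (m + 2 * real k + 1)
            * ?W t (\<lambda>x. damping \<alpha> x * ((time_deriv ^^ Suc k) u t x)\<^sup>2))) \<and>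
        (\<forall>t\<ge>0. c * (1 + t) powr (m + 2 * real k) * ?W t (\<lambda>x. damping \<alpha> x * ((time_deriv ^^ k) u t x)\<^sup>2)
          + c * (1 + t) powr (m + 2 * real k + 1) * ?W t (\<lambda>x. (norm (grad ((time_deriv ^^ k) u t) x))\<^sup>2)
          \<le> F t) \<and>
        F 0 \<le> C * initial_energy \<alpha> \<delta> (u 0) (time_deriv u 0) u k"
        by blast
      have decay: "integrable lborel (\<lambda>x. exp (2 * weight \<alpha> \<delta> t x) * damping \<alpha> x * \<bar>(time_deriv ^^ k) u t x\<bar>\<^sup>2) \<and>
          (1 + t) powr (m0 + 2 * real k - \<epsilon>) *
            (LINT x|lborel. exp (2 * weight \<alpha> \<delta> t x) * damping \<alpha> x * \<bar>(time_deriv ^^ k) u t x\<bar>\<^sup>2)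
            \<le> C / c * initial_energy \<alpha> \<delta> u0 u1 u k \<and>
          integrable lborel (\<lambda>x. exp (2 * weight \<alpha> \<delta> t x) * (norm (grad ((time_deriv ^^ k) u t) x))\<^sup>2) \<and>
          (1 + t) powr (m0 + 2 * real k + 1 - \<epsilon>) *
            (LINT x|lborel. exp (2 * weight \<alpha> \<delta> t x) * (norm (grad ((time_deriv ^^ k) u t) x))\<^sup>2)
            \<le> C / c * initial_energy \<alpha> \<delta> u0 u1 u k"
        if u: "supp u0 \<union> supp u1 \<subseteq> cball 0 L" "damped_wave_solution \<alpha> u0 u1 u" and t: "t \<ge> 0"
        for u0 u1 :: "real^'n \<Rightarrow> real" and u t
      proof -
        have data: "u 0 = u0" "time_deriv u 0 = u1"
          using u(2) by (auto simp: damped_wave_solution_def)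
        have sol: "supported_wave \<alpha> L u"
          by (rule supported_wave_of_solution[OF u(2,1)])
        define V where "V = ?W t (\<lambda>x. damping \<alpha> x * ((time_deriv ^^ k) u t x)\<^sup>2)"
        define Y where "Y = ?W t (\<lambda>x. (norm (grad ((time_deriv ^^ k) u t) x))\<^sup>2)"
        have nonneg: "V \<ge> 0" "Y \<ge> 0"
          unfolding V_def Y_def by (intro weighted_integral_nonneg[OF assms(1,2) \<delta>];
              simp add: less_imp_le[OF damping_pos])+
        from lyap[OF sol] obtain F where cont: "\<And>T. continuous_on {0..T} F"
          and deriv: "\<And>t. t > 0 \<Longrightarrow> \<exists>D. (F has_real_derivative D) (at t) \<and>
            D \<le> - (c * (1 + t) powr (m + 2 * real k + 1)
              * ?W t (\<lambda>x. damping \<alpha> x * ((time_deriv ^^ Suc k) u t x)\<^sup>2))"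
          and lower: "c * (1 + t) powr (m + 2 * real k) * V + c * (1 + t) powr (m + 2 * real k + 1) * Y \<le> F t"
          and initial: "F 0 \<le> C * initial_energy \<alpha> \<delta> u0 u1 u k"
          using t unfolding data V_def Y_def by blast
        have "F t \<le> F 0"
        proof (rule DERIV_nonpos_imp_decreasing_open[OF t _ cont])
          fix s :: real assume "0 < s"
          have "0 \<le> c * (1 + s) powr (m + 2 * real k + 1)
              * ?W s (\<lambda>x. damping \<alpha> x * ((time_deriv ^^ Suc k) u s x)\<^sup>2)"
            using c by (intro mult_nonneg_nonneg weighted_integral_nonneg[OF assms(1,2) \<delta>])
              (auto simp: less_imp_le[OF damping_pos])
          with deriv[OF \<open>0 < s\<close>] show "\<exists>D. (F has_real_derivative D) (at s) \<and> D \<le> 0"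
            by (meson neg_le_0_iff_le order_trans)
        qed
        with lower initial
        have sum: "c * ((1 + t) powr (m + 2 * real k) * V) + c * ((1 + t) powr (m + 2 * real k + 1) * Y)
            \<le> C * initial_energy \<alpha> \<delta> u0 u1 u k" by (simp add: mult.assoc)
        have "0 \<le> c * ((1 + t) powr (m + 2 * real k) * V)" "0 \<le> c * ((1 + t) powr (m + 2 * real k + 1) * Y)"
          using c nonneg by simp_all
        with sum have "c * ((1 + t) powr (m + 2 * real k) * V) \<le> C * initial_energy \<alpha> \<delta> u0 u1 u k"
          "c * ((1 + t) powr (m + 2 * real k + 1) * Y) \<le> C * initial_energy \<alpha> \<delta> u0 u1 u k"
          by linarith+
        then have "(1 + t) powr (m + 2 * real k) * V \<le> C / c * initial_energy \<alpha> \<delta> u0 u1 u k"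
          "(1 + t) powr (m + 2 * real k + 1) * Y \<le> C / c * initial_energy \<alpha> \<delta> u0 u1 u k"
          using c by (simp_all add: field_simps)
        then show ?thesis
          using integrable_weighted_wave(1,3)[OF assms(1,2) \<delta> supported_wave_funpow[OF sol, of k] t]
          unfolding e1 e2 V_def Y_def weighted_integral_def power2_abs by (simp add: mult.assoc)
      qed
      show "\<exists>C>0. \<forall>(u0 :: real^'n \<Rightarrow> real) u1 u.
        smooth_on UNIV u0 \<and> smooth_on UNIV u1 \<and> supp u0 \<union> supp u1 \<subseteq> cball 0 L \<and>
        damped_wave_solution \<alpha> u0 u1 u \<longrightarrow>
        (\<forall>t\<ge>0.
          integrable lborel
            (\<lambda>x. exp (2 * weight \<alpha> \<delta> t x) * damping \<alpha> x * \<bar>(time_deriv ^^ k) u t x\<bar>\<^sup>2) \<and>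
          (1 + t) powr (m0 + 2 * real k - \<epsilon>) *
            (LINT x|lborel. exp (2 * weight \<alpha> \<delta> t x) * damping \<alpha> x * \<bar>(time_deriv ^^ k) u t x\<bar>\<^sup>2)
            \<le> C * initial_energy \<alpha> \<delta> u0 u1 u k \<and>
          integrable lborel
            (\<lambda>x. exp (2 * weight \<alpha> \<delta> t x) * (norm (grad ((time_deriv ^^ k) u t) x))\<^sup>2) \<and>
          (1 + t) powr (m0 + 2 * real k + 1 - \<epsilon>) *
            (LINT x|lborel. exp (2 * weight \<alpha> \<delta> t x) * (norm (grad ((time_deriv ^^ k) u t) x))\<^sup>2)
            \<le> C * initial_energy \<alpha> \<delta> u0 u1 u k)"
        by (rule exI[of _ "C / c"], rule conjI, rule divide_pos_pos[OF C c], intro allI impI, elim conjE)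
           (rule decay)
    qed
  qed
qed

end
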